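(* Let $k$ be a positive integer. The center of the graded ring $H^k$ is a free graded abelian group of rank $$\binom{2k}{i}-\binom{2k}{i-1}$$ in degree $2i$, for $i=0,\ldots,k$, and zero in all other degrees. The total rank of the center is $\binom{2k}{k}$.
   Context: Binomial coefficients $\binom{a}{b}$ are zero unless $a\ge b\ge0$. $H^k$ is Khovanov's ring of crossingless matchings, defined as follows. Let $A=\mathbb{Z}[X]/(X^2)$, graded by $\deg 1=-1$, $\deg X=1$, with its Frobenius algebra structure: multiplication $m$ and comultiplication $\Delta(1)=1\otimes X+X\otimes 1$, $\Delta(X)=X\otimes X$, unit $1$, counit $\varepsilon(1)=0,\ \varepsilon(X)=1$. Let $\mathcal{F}$ be the associated 2-dimensional TQFT, assigning $A^{\otimes r}$ to a disjoint union of $r$ circles. Let $B^k$ be the set of crossingless matchings of $2k$ points on a line (isotopy classes of systems of $k$ disjoint arcs in a half-plane with these endpoints). For $a,b\in B^k$ let $W(b)a$ be the closed 1-manifold in the plane obtained by gluing $a$ to the reflection $W(b)$ of $b$ in the line. As a graded abelian group, $$H^k=\bigoplus_{a,b\in B^k}{}_b(H^k)_a,\qquad {}_b(H^k)_a=\mathcal{F}(W(b)a)\{k\},$$ where $\{k\}$ raises the degree by $k$. The product ${}_d(H^k)_c\otimes{}_b(H^k)_a\to{}_d(H^k)_a$ is zero if $b\ne c$; if $b=c$, it is induced by $\mathcal{F}$ applied to the minimal cobordism $W(d)b\sqcup W(b)a\to W(d)a$, which merges $bW(b)$ into $2k$ vertical segments by $k$ saddles. This makes $H^k$ an associative unital nonnegatively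 graded ring. *)

theory Defs
  imports "HOL-Algebra.Free_Abelian_Groups" "HOL-Algebra.Ring"
begin

section \<open>The Frobenius algebra \<open>A = \<int>[X]/(X\<^sup>2)\<close>\<close>

text \<open>
  \<open>A\<close> is the free abelian group on \<open>{1, X}\<close>, that is \<open>frob \<Rightarrow>\<^sub>0 int\<close>, and \<open>A \<otimes> A\<close> is
  \<open>frob \<times> frob \<Rightarrow>\<^sub>0 int\<close>. The structure maps are given on basis elements and are extended
  linearly by \<^const>\<open>frag_extend\<close> wherever they are applied.
\<close>

datatype frob = One | X

fun frob_deg :: "frob \<Rightarrow> int" where
  "frob_deg One = -1"
| "frob_deg X = 1"

fun frob_mult :: "frob \<Rightarrow> frob \<Rightarrow> (frob \<Rightarrow>\<^sub>0 int)" where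
  "frob_mult One x = frag_of x"
| "frob_mult X One = frag_of X"
| "frob_mult X X = 0"

fun frob_comult :: "frob \<Rightarrow> (frob \<times> frob \<Rightarrow>\<^sub>0 int)" where
  "frob_comult One = frag_of (One, X) + frag_of (X, One)"
| "frob_comult X = frag_of (X, X)"


section \<open>Crossingless matchings and closed 1-manifolds\<close>

type_synonym matching = "(nat \<times> nat) set"

text \<open>
  The \<open>2k\<close> points are \<open>0, \<dots>, 2k - 1\<close>. An isotopy class of systems of \<open>k\<close> disjoint arcs in a
  half-plane is encoded by the pairs \<open>(i, j)\<close>, \<open>i < j\<close>, of endpoints of its arcs; two such arcs
  can be made disjoint iff their endpoints do not interleave.
\<close>

definition crossingless_matchings :: "nat \<Rightarrow> matching set" where
  "crossingless_matchings k =
    {a. a \<subseteq> {(i, j). i < j \<and> j < 2 * k} \<and>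
        (\<forall>p < 2 * k. \<exists>!e. e \<in> a \<and> (p = fst e \<or> p = snd e)) \<and>
        (\<forall>(p, q) \<in> a. \<forall>(r, s) \<in> a. \<not> (p < r \<and> r < q \<and> q < s))}"

text \<open>
  A closed 1-manifold is cut at finitely many points into arcs. It is recorded as the set \<open>V\<close> of
  these points and the set \<open>E\<close> of pairs of endpoints of the arcs; a circle is recorded as the set
  of points of \<open>V\<close> on it, that is, as a connected component of the graph \<open>(V, E)\<close>.
\<close>

definition circle_of :: "('p \<times> 'p) set \<Rightarrow> 'p \<Rightarrow> 'p set" where
  "circle_of E p = (E \<union> E\<inverse>)\<^sup>* `` {p}"

definition circles :: "'p set \<Rightarrow> ('p \<times> 'p) set \<Rightarrow> 'p set set" where
  "circles V E = circle_of E ` V"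

text \<open>
  \<open>\<F>\<close> of a closed 1-manifold with set of circles \<open>P\<close> is \<open>A\<^bsup>\<otimes>P\<^esup>\<close>. Its standard basis consists of the
  labellings of the circles by \<open>1\<close> and \<open>X\<close>.
\<close>

definition labellings :: "'p set set \<Rightarrow> ('p set \<Rightarrow> frob) set" where
  "labellings P = P \<rightarrow>\<^sub>E UNIV"

definition W_circles :: "nat \<Rightarrow> matching \<Rightarrow> matching \<Rightarrow> nat set set" where
  "W_circles k b a = circles {..<2 * k} (a \<union> b)"


section \<open>The minimal cobordism \<open>W(d)b \<squnion> W(b)a \<rightarrow> W(d)a\<close>\<close>

text \<open>
  \<open>Inl p\<close> is the point \<open>p\<close> on the line carrying \<open>W(b)a\<close>, and \<open>Inr p\<close> is the point \<open>p\<close> on the line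
  carrying \<open>W(d)b\<close>. In the intermediate 1-manifold below, the saddles at the arcs in \<open>T \<subseteq> b\<close> have
  been performed: the arc \<open>(i, j) \<in> T\<close> and its mirror image are replaced by the vertical segments
  at \<open>i\<close> and \<open>j\<close>.
\<close>

type_synonym point2 = "nat + nat"

definition stage_arcs ::
  "matching \<Rightarrow> matching \<Rightarrow> matching \<Rightarrow> matching \<Rightarrow> (point2 \<times> point2) set" where
  "stage_arcs d b a T =
     map_prod Inl Inl ` (a \<union> (b - T)) \<union> map_prod Inr Inr ` (d \<union> (b - T)) \<union>
     (\<Union>(i, j) \<in> T. {(Inl i, Inr i), (Inl j, Inr j)})"

definition stage_circles ::
  "nat \<Rightarrow> matching \<Rightarrow> matching \<Rightarrow> matching \<Rightarrow> matching \<Rightarrow> point2 set set" where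
  "stage_circles k d b a T = circles ({..<2 * k} <+> {..<2 * k}) (stage_arcs d b a T)"

text \<open>
  The map induced on basis elements by the saddle at \<open>(i, j)\<close>: if the arc \<open>(i, j)\<close> and its mirror
  image lie on two circles, these are merged and \<open>m\<close> is applied; if they lie on one circle, it is
  split into the circles through the two vertical segments and \<open>\<Delta>\<close> is applied. The other circles,
  and their labels, are unchanged.
\<close>

definition saddle ::
  "nat \<Rightarrow> matching \<Rightarrow> matching \<Rightarrow> matching \<Rightarrow> matching \<Rightarrow> nat \<times> nat \<Rightarrow>
    (point2 set \<Rightarrow> frob) \<Rightarrow> ((point2 set \<Rightarrow> frob) \<Rightarrow>\<^sub>0 int)" where
  "saddle k d b a T e f =
    (let i = fst e; j = snd e;
         E = stage_arcs d b a T;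
         E' = stage_arcs d b a (insert e T);
         P' = stage_circles k d b a (insert e T);
         C = circle_of E (Inl i); D = circle_of E (Inr i);
         C' = circle_of E' (Inl i); D' = circle_of E' (Inl j)
     in if C \<noteq> D
        then frag_extend (\<lambda>x. frag_of (restrict (f(C' := x)) P')) (frob_mult (f C) (f D))
        else frag_extend (\<lambda>(x, y). frag_of (restrict (f(C' := x, D' := y)) P')) (frob_comult (f C)))"

fun saddles ::
  "nat \<Rightarrow> matching \<Rightarrow> matching \<Rightarrow> matching \<Rightarrow> matching \<Rightarrow> (nat \<times> nat) list \<Rightarrow>
    ((point2 set \<Rightarrow> frob) \<Rightarrow>\<^sub>0 int) \<Rightarrow> ((point2 set \<Rightarrow> frob) \<Rightarrow>\<^sub>0 int)" where
  "saddles k d b a T [] u = u"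
| "saddles k d b a T (e # es) u =
     saddles k d b a (insert e T) es (frag_extend (saddle k d b a T e) u)"

definition disjoint_union_labelling ::
  "nat \<Rightarrow> matching \<Rightarrow> matching \<Rightarrow> matching \<Rightarrow> (nat set \<Rightarrow> frob) \<Rightarrow> (nat set \<Rightarrow> frob) \<Rightarrow>
    (point2 set \<Rightarrow> frob)" where
  "disjoint_union_labelling k d b a g f =
     (\<lambda>C \<in> stage_circles k d b a {}. if C \<subseteq> range Inl then f (Inl -` C) else g (Inr -` C))"

text \<open>
  After all \<open>k\<close> saddles, contracting the vertical segments identifies the circle \<open>C <+> C\<close> with the
  circle \<open>C\<close> of \<open>W(d)a\<close>. The saddles are performed in the order of the left endpoints of the arcs,
  so that an arc comes before those nested inside it and each saddle takes place in the plane.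
\<close>

definition cobordism_map ::
  "nat \<Rightarrow> matching \<Rightarrow> matching \<Rightarrow> matching \<Rightarrow> (nat set \<Rightarrow> frob) \<Rightarrow> (nat set \<Rightarrow> frob) \<Rightarrow>
    ((nat set \<Rightarrow> frob) \<Rightarrow>\<^sub>0 int)" where
  "cobordism_map k d b a g f =
     frag_extend (\<lambda>h. frag_of (\<lambda>C \<in> W_circles k d a. h (C <+> C)))
       (saddles k d b a {} (sorted_key_list_of_set fst b)
         (frag_of (disjoint_union_labelling k d b a g f)))"


section \<open>The ring \<open>H\<^sup>k\<close>\<close>

text \<open>
  The basis element \<open>(b, a, f)\<close> is the labelling \<open>f\<close> of the circles of \<open>W(b)a\<close>, as an element of
  the summand \<open>\<F>(W(b)a){k}\<close>.
\<close>

type_synonym arc_gen = "matching \<times> matching \<times> (nat set \<Rightarrow> frob)"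

definition arc_gens :: "nat \<Rightarrow> arc_gen set" where
  "arc_gens k = {(b, a, f). b \<in> crossingless_matchings k \<and> a \<in> crossingless_matchings k \<and>
                            f \<in> labellings (W_circles k b a)}"

fun arc_deg :: "nat \<Rightarrow> arc_gen \<Rightarrow> int" where
  "arc_deg k (b, a, f) = (\<Sum>C \<in> W_circles k b a. frob_deg (f C)) + int k"

fun arc_gen_mult :: "nat \<Rightarrow> arc_gen \<Rightarrow> arc_gen \<Rightarrow> (arc_gen \<Rightarrow>\<^sub>0 int)" where
  "arc_gen_mult k (d, c, g) (b, a, f) =
     (if b = c then frag_extend (\<lambda>h. frag_of (d, a, h)) (cobordism_map k d b a g f) else 0)"

definition arc_ring :: "nat \<Rightarrow> (arc_gen \<Rightarrow>\<^sub>0 int) ring" where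
  "arc_ring k =
    \<lparr>carrier = {u. Poly_Mapping.keys u \<subseteq> arc_gens k},
     mult = (\<lambda>u v. frag_extend (\<lambda>p. frag_extend (\<lambda>q. arc_gen_mult k p q) v) u),
     one = (\<Sum>a \<in> crossingless_matchings k. frag_of (a, a, \<lambda>C \<in> W_circles k a a. One)),
     zero = 0,
     add = (+)\<rparr>"

definition homogeneous_component :: "nat \<Rightarrow> int \<Rightarrow> (arc_gen \<Rightarrow>\<^sub>0 int) \<Rightarrow> (arc_gen \<Rightarrow>\<^sub>0 int)" where
  "homogeneous_component k n u =
     frag_extend (\<lambda>p. if arc_deg k p = n then frag_of p else 0) u"


section \<open>Centers and ranks\<close>

definition ring_center :: "('a, 'm) ring_scheme \<Rightarrow> 'a set" where
  "ring_center R = {z \<in> carrier R. \<forall>x \<in> carrier R. z \<otimes>\<^bsub>R\<^esub> x = x \<otimes>\<^bsub>R\<^esub> z}"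

definition center_in_degree :: "nat \<Rightarrow> int \<Rightarrow> (arc_gen \<Rightarrow>\<^sub>0 int) set" where
  "center_in_degree k n =
     {z \<in> ring_center (arc_ring k). \<forall>p \<in> Poly_Mapping.keys z. arc_deg k p = n}"

abbreviation additive_group_on :: "('a, 'm) ring_scheme \<Rightarrow> 'a set \<Rightarrow> ('a, 'm) monoid_scheme" where
  "additive_group_on R S \<equiv> (add_monoid R)\<lparr>carrier := S\<rparr>"

definition free_abelian_of_rank :: "('a, 'm) monoid_scheme \<Rightarrow> int \<Rightarrow> bool" where
  "free_abelian_of_rank G n \<longleftrightarrow> (\<exists>r :: nat. int r = n \<and> G \<cong> free_Abelian_group {..<r})"

definition binom :: "int \<Rightarrow> int \<Rightarrow> int" where
  "binom a b = (if a \<ge> b \<and> b \<ge> 0 then int (nat a choose nat b) else 0)"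

end

(*
  By the unit idempotents 1_a, a central element is diagonal, and it commutes with the generator
  1 of F(W(b)a) iff its components at a and b agree in F(W(b)a) = Z[X_0, ..., X_(2k-1)] modulo
  X_t^2 and X_i = X_j for the arcs (i, j) of a and b. In these products every saddle is a merge.
  The monomials X_T thus give central elements. Conversely, unnesting two nested arcs expresses
  the coefficient of a monomial X_S at a matching a by coefficients with shorter arcs, until S
  contains all nested arcs of a. Such pairs (a, S) correspond to ballot sets T via the right
  endpoints of S, and the coefficients of the X_T at these pairs form a unitriangular matrix for
  the order by the sum of the elements of T. Hence the X_T with T ballot form a basis of the
  center, and X_T has degree 2|T|.
*)

theory Submission
  imports Defs
begin

section \<open>Crossingless matchings and ballot sets\<close>

text \<open>Over the integers, equality of ranks would not be enough: independent classes X_T of the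
  right number could span a proper subgroup of finite index. So the coefficients at the pairs (a, S)
  in which S contains all nested arcs serve as coordinates. They determine a central element, and
  the diagonal entries 1 let the matrix be inverted without division. The two directions use
  commutation differently. X_T has to commute with all of F(W(b)a); this comes from a symmetric
  rule, since the exponent of X on a circle is the number of elements of T on it, from whichever
  side one multiplies. Beyond diagonality, the converse compares only matchings a, c that differ by
  one unnesting: W(a)c then has a single four-point circle, and each of its two possible labels
  gives one linear relation.\<close>

definition matching_on :: "nat set \<Rightarrow> matching \<Rightarrow> bool" where
  "matching_on V a \<longleftrightarrow>
     a \<subseteq> {(i, j). i < j \<and> i \<in> V \<and> j \<in> V} \<and>
     (\<forall>p \<in> V. \<exists>!e. e \<in> a \<and> (p = fst e \<or> p = snd e)) \<and>
     (\<forall>(p, q) \<in> a. \<forall>(r, s) \<in> a. \<not> (p < r \<and> r < q \<and> q < s))"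

text \<open>With the point set as a parameter of \<open>matching_on\<close>, an arc can be deleted
  together with its endpoints without renumbering the other points.\<close>

lemma crossingless_matchings_iff:
  "a \<in> crossingless_matchings k \<longleftrightarrow> matching_on {..<2 * k} a"
  unfolding crossingless_matchings_def matching_on_def
  by (auto simp: Ball_def subset_iff intro: less_trans)

lemma matching_onD:
  assumes "matching_on V a" "(i, j) \<in> a"
  shows "i < j" "i \<in> V" "j \<in> V"
  using assms unfolding matching_on_def by auto

lemma matching_on_share:
  assumes "matching_on V a" "(i, j) \<in> a" "(r, s) \<in> a" "i = r \<or> i = s \<or> j = r \<or> j = s"
  shows "i = r \<and> j = s"
proof -
  obtain p where p: "p \<in> {i, j}" "p \<in> {r, s}" "p \<in> V"
    using assms(4) matching_onD(2,3)[OF assms(1,2)] by auto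
  then have ex1: "\<exists>!e. e \<in> a \<and> (p = fst e \<or> p = snd e)"
    using assms(1) by (simp add: matching_on_def)
  have "p = fst (i, j) \<or> p = snd (i, j)" "p = fst (r, s) \<or> p = snd (r, s)"
    using p(1,2) by auto
  then have "(i, j) = (r, s)"
    using ex1 assms(2,3) by blast
  then show ?thesis by simp
qed

lemma matching_on_cover:
  assumes "matching_on V a" "p \<in> V"
  obtains r s where "(r, s) \<in> a" "p = r \<or> p = s"
  using assms unfolding matching_on_def by (metis prod.collapse)

lemma matching_on_noncrossing:
  assumes "matching_on V a" "(p, q) \<in> a" "(r, s) \<in> a" "p < r" "r < q" 
  shows "\<not> q < s"
proof -
  have "\<forall>(p, q) \<in> a. \<forall>(r, s) \<in> a. \<not> (p < r \<and> r < q \<and> q < s)"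
    using assms(1) by (simp add: matching_on_def)
  then show ?thesis using assms(2-) by fastforce
qed

lemma matching_onI:
  assumes "\<And>i j. (i, j) \<in> a \<Longrightarrow> i < j \<and> i \<in> V \<and> j \<in> V"
    and "\<And>p. p \<in> V \<Longrightarrow> \<exists>r s. (r, s) \<in> a \<and> (p = r \<or> p = s)"
    and "\<And>i j r s. (i, j) \<in> a \<Longrightarrow> (r, s) \<in> a \<Longrightarrow> i = r \<or> i = s \<or> j = r \<or> j = s \<Longrightarrow> i = r \<and> j = s"
    and "\<And>p q r s. (p, q) \<in> a \<Longrightarrow> (r, s) \<in> a \<Longrightarrow> p < r \<Longrightarrow> r < q \<Longrightarrow> q < s \<Longrightarrow> False"
  shows "matching_on V a"
  unfolding matching_on_def
proof (intro conjI ballI)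
  show "a \<subseteq> {(i, j). i < j \<and> i \<in> V \<and> j \<in> V}" using assms(1) by auto
  show "\<exists>!e. e \<in> a \<and> (p = fst e \<or> p = snd e)" if p: "p \<in> V" for p
  proof -
    obtain r s where rs: "(r, s) \<in> a" "p = r \<or> p = s" using assms(2)[OF p] by blast
    have "e = (r, s)" if "e \<in> a \<and> (p = fst e \<or> p = snd e)" for e
      using that rs(2) assms(3)[of "fst e" "snd e" r s] rs(1) by (metis prod.collapse)
    then show ?thesis using rs by (intro ex1I[of _ "(r, s)"]) auto
  qed
  show "case x of (p, q) \<Rightarrow> \<forall>(r, s)\<in>a. \<not> (p < r \<and> r < q \<and> q < s)" if "x \<in> a" for x
  proof -
    obtain p q where x: "x = (p, q)" by force
    have "\<forall>(r, s)\<in>a. \<not> (p < r \<and> r < q \<and> q < s)"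
      using assms(4)[of p q] that x by blast
    then show ?thesis using x by simp
  qed
qed

lemma finite_matching:
  assumes "matching_on V a" "finite V"
  shows "finite a"
  by (rule finite_subset[of _ "V \<times> V"]) (use assms in \<open>auto dest: matching_onD\<close>)

section \<open>Cup diagrams of ballot sets\<close>

definition outer :: "matching \<Rightarrow> matching \<Rightarrow> bool" where
  "outer a S \<longleftrightarrow> S \<subseteq> a \<and> (\<forall>i j p q. (i, j) \<in> a \<longrightarrow> (p, q) \<in> a \<longrightarrow> p < i \<longrightarrow> j < q \<longrightarrow> (i, j) \<in> S)"

text \<open>Ballot sequences: reading V from left to right, with elements of T as closing and all
  other points as opening brackets, no prefix has more closing than opening ones.\<close>

definition ballot :: "nat set \<Rightarrow> nat set \<Rightarrow> bool" where
  "ballot V T \<longleftrightarrow> T \<subseteq> V \<and> (\<forall>m. 2 * card (T \<inter> {..<m}) \<le> card (V \<inter> {..<m}))"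

lemma matching_on_insert_adjacent:
  assumes "matching_on (V - {i, j}) a" "i \<in> V" "j \<in> V" "i < j" "V \<inter> {i<..<j} = {}"
  shows "matching_on V (insert (i, j) a)"
proof (rule matching_onI)
  note D = matching_onD[OF assms(1)]
  show "r < s \<and> r \<in> V \<and> s \<in> V" if "(r, s) \<in> insert (i, j) a" for r s
    using that D assms by blast
  show "\<exists>r s. (r, s) \<in> insert (i, j) a \<and> (p = r \<or> p = s)" if "p \<in> V" for p
  proof (cases "p \<in> {i, j}")
    case False
    then have "p \<in> V - {i, j}" using that by auto
    then show ?thesis using matching_on_cover[OF assms(1)] by (metis insertCI)
  qed auto
  show "p = r \<and> q = s" if "(p, q) \<in> insert (i, j) a" "(r, s) \<in> insert (i, j) a"
    "p = r \<or> p = s \<or> q = r \<or> q = s" for p q r s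
    using that D(2,3) matching_on_share[OF assms(1), of p q r s] by blast
  show False if "(p, q) \<in> insert (i, j) a" "(r, s) \<in> insert (i, j) a" "p < r" "r < q" "q < s" for p q r s
  proof -
    have no: "\<not> (i < x \<and> x < j)" if "x \<in> V" for x using assms(5) that by auto
    show False
      using that D no matching_on_noncrossing[OF assms(1), of p q r s] by blast
  qed
qed

lemma matching_on_remove:
  assumes "matching_on V a" "(i, j) \<in> a"
  shows "matching_on (V - {i, j}) (a - {(i, j)})"
proof (rule matching_onI)
  note sh = matching_on_share[OF assms(1)]
  show "r < s \<and> r \<in> V - {i, j} \<and> s \<in> V - {i, j}" if "(r, s) \<in> a - {(i, j)}" for r s
    using that matching_onD[OF assms(1), of r s] sh[OF assms(2), of r s] by auto
  show "\<exists>r s. (r, s) \<in> a - {(i, j)} \<and> (p = r \<or> p = s)" if "p \<in> V - {i, j}" for p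
  proof -
    have "p \<in> V" using that by auto
    then obtain r s where "(r, s) \<in> a" "p = r \<or> p = s" using matching_on_cover[OF assms(1)] by metis
    then show ?thesis using that by auto
  qed
qed (use matching_on_share[OF assms(1)] matching_on_noncrossing[OF assms(1)] in blast)+

lemma ballot_empty: "ballot V {}" 
  by (simp add: ballot_def)

text \<open>Since j is the least element of T, prefixes up to j contain nothing of the new set, and
  every longer prefix loses both i and j, which lowers each side by two.\<close>

lemma ballot_remove:
  assumes "finite V" "ballot V T" "j \<in> T" "\<And>t. t \<in> T \<Longrightarrow> j \<le> t" "i \<in> V" "i < j"
  shows "ballot (V - {i, j}) (T - {j})"
  unfolding ballot_def
proof (intro conjI allI)
  have TV: "T \<subseteq> V" using assms(2) by (simp add: ballot_def)
  have iT: "i \<notin> T" using assms(4,6) by force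
  show "T - {j} \<subseteq> V - {i, j}" using TV iT by auto
  fix m
  have fT: "finite T" using TV assms(1) finite_subset by blast
  show "2 * card ((T - {j}) \<inter> {..<m}) \<le> card ((V - {i, j}) \<inter> {..<m})"
  proof (cases "m \<le> j")
    case True
    then have "(T - {j}) \<inter> {..<m} = {}" using assms(4) by force
    then show ?thesis by simp
  next
    case False
    have "card (T \<inter> {..<m} - {j}) = card (T \<inter> {..<m}) - 1"
      using False assms(3) fT by (intro card_Diff_singleton) auto
    moreover have "card (V \<inter> {..<m} - {i, j}) = card (V \<inter> {..<m}) - card {i, j}"
      using False assms TV by (intro card_Diff_subset) auto
    moreover have "card {i, j} = 2" using assms(6) by simp
    moreover have "2 * card (T \<inter> {..<m}) \<le> card (V \<inter> {..<m})" using assms(2) by (simp add: ballot_def)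
    moreover have "(T - {j}) \<inter> {..<m} = T \<inter> {..<m} - {j}" "(V - {i, j}) \<inter> {..<m} = V \<inter> {..<m} - {i, j}" by auto
    ultimately show ?thesis by simp
  qed
qed

text \<open>Only outermost arcs may be missing from \<open>snd D\<close>. They lie side by side, so
  they join the leftover points consecutively, while the arcs in \<open>snd D\<close> form the
  bracket matching with closing brackets T. Hence T alone will determine D.\<close>

definition cup_diagram :: "nat set \<Rightarrow> nat set \<Rightarrow> matching \<times> matching \<Rightarrow> bool" where
  "cup_diagram V T D \<longleftrightarrow> matching_on V (fst D) \<and> outer (fst D) (snd D) \<and> snd ` snd D = T"

text \<open>With no arc in the second component, no arc may lie under another. If the least point i
  were joined to a point beyond its neighbour j, the arc at j would start there and be
  enclosed.\<close>

lemma cup_diagram_empty_arc: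
  assumes D: "matching_on V a" "outer a {}" 
    and i: "i \<in> V" "\<And>v. v \<in> V \<Longrightarrow> i \<le> v" and j: "j \<in> V" "i < j" "V \<inter> {i<..<j} = {}"
  shows "(i, j) \<in> a"
proof -
  obtain r s where rs: "(r, s) \<in> a" "i = r \<or> i = s" using matching_on_cover[OF D(1) i(1)] .
  then have r: "r = i" using matching_onD[OF D(1) rs(1)] i by force
  have s: "j \<le> s" using matching_onD[OF D(1) rs(1)] j r by force
  obtain p q where pq: "(p, q) \<in> a" "j = p \<or> j = q" using matching_on_cover[OF D(1) j(1)] .
  show ?thesis
  proof (cases "j = s")
    case True then show ?thesis using rs r by simp
  next
    case False
    then have js: "j < s" using s by simp
    have "p \<noteq> i" using matching_on_share[OF D(1) rs(1) pq(1)] pq r False j by auto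
    have "j = p"
    proof (rule ccontr)
      assume "j \<noteq> p"
      then have "p < j" "p \<in> V" "i \<le> p" using pq matching_onD[OF D(1) pq(1)] i by auto
      then show False using j \<open>p \<noteq> i\<close> by auto
    qed
    then have "\<not> s < q" using matching_on_noncrossing[OF D(1) rs(1) pq(1)] r js j by auto
    moreover have "q \<noteq> s" using matching_on_share[OF D(1) rs(1) pq(1)] \<open>p \<noteq> i\<close> r by auto
    ultimately have "i < p" "q < s" using \<open>j = p\<close> j by auto
    then have "(p, q) \<in> {}" using D(2) rs(1) pq(1) r unfolding outer_def by blast
    then show ?thesis by simp
  qed
qed

text \<open>If the arc of S ending in j started to the left of i, it would enclose the arc at i. As
  a left endpoint, i would need a partner strictly between i and j; as a right endpoint, it would
  close a nested arc, hence one in S, and belong to T.\<close>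

lemma cup_diagram_adjacent_arc:
  assumes D: "matching_on V a" "outer a S" "snd ` S = T" 
    and i: "i \<in> V" "i \<notin> T" and j: "j \<in> T" "i < j" "V \<inter> {i<..<j} = {}"
  shows "(i, j) \<in> S"
proof -
  obtain l where l: "(l, j) \<in> S" using j(1) D(3) by (metis imageE prod.collapse)
  have la: "(l, j) \<in> a" using l D(2) unfolding outer_def by auto
  have "l \<le> i" using matching_onD[OF D(1) la] j by force
  show ?thesis
  proof (cases "l = i")
    case True then show ?thesis using l by simp
  next
    case False
    then have li: "l < i" using \<open>l \<le> i\<close> by simp
    obtain r s where rs: "(r, s) \<in> a" "i = r \<or> i = s" using matching_on_cover[OF D(1) i(1)] .
    have ne: "r \<noteq> l" "s \<noteq> j" "s \<noteq> l" "r \<noteq> j" using matching_on_share[OF D(1) rs(1) la] rs(2) False j(2) by blast+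
    from rs(2) show ?thesis
    proof
      assume "i = r"
      then have "\<not> j < s" using matching_on_noncrossing[OF D(1) la rs(1)] li j by auto
      then have "s \<in> V \<inter> {i<..<j}" using matching_onD[OF D(1) rs(1)] ne \<open>i = r\<close> by auto
      then show ?thesis using j by auto
    next
      assume "i = s"
      then have "\<not> r < l" using matching_on_noncrossing[OF D(1) rs(1) la] li j by auto
      then have "l < r" "s < j" using ne \<open>i = s\<close> j by auto
      then have "(r, s) \<in> S" using D(2) la rs(1) unfolding outer_def by blast
      then have "i \<in> T" using D(3) \<open>i = s\<close> by force
      then show ?thesis using i by simp
    qed
  qed
qed

lemma outer_remove: "outer a S \<Longrightarrow> outer (a - {e}) (S - {e})"
  unfolding outer_def by blast

text \<open>Bracket matching, by induction on the number of points. If T is nonempty, its least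
  element is matched with the preceding point of V; otherwise the two least points are joined by an
  arc outside the second component. Every diagram must contain this arc, so removing it gives
  uniqueness.\<close>

lemma ex1_cup_diagram:
  assumes "finite V" "even (card V)" "ballot V T"
  shows "\<exists>!D. cup_diagram V T D"
  using assms
proof (induction "card V" arbitrary: V T rule: less_induct)
  case less
  have TV: "T \<subseteq> V" using less.prems by (simp add: ballot_def)
  show ?case
  proof (cases "V = {}")
    case True
    have "cup_diagram V T ({}, {})"
      using True TV by (auto simp: cup_diagram_def matching_on_def outer_def)
    moreover have "D = ({}, {})" if "cup_diagram V T D" for D
      using that True by (cases D) (auto simp: cup_diagram_def matching_on_def outer_def)
    ultimately show ?thesis by (rule ex1I)
  next
    case False
    have card': "card (V - {i, j}) < card V \<and> even (card (V - {i, j}))" 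
      if "i \<in> V" "j \<in> V" "i < j" for i j
    proof -
      have "card (V - {i, j}) = card V - 2"
        using that less.prems(1) by (subst card_Diff_subset) auto
      moreover have "card V \<noteq> 0" using False less.prems(1) by simp
      ultimately show ?thesis using less.prems(2) by (auto)
    qed
    show ?thesis
    proof (cases "T = {}")
      case True
      define i where "i = Min V"
      have i: "i \<in> V" "\<And>v. v \<in> V \<Longrightarrow> i \<le> v"
        using False less.prems(1) by (auto simp: i_def)
      have "V \<noteq> {i}" using less.prems(2) by auto
      then have ne: "V - {i} \<noteq> {}" using i by auto
      define j where "j = Min (V - {i})"
      have "j \<in> V - {i}" unfolding j_def using ne less.prems(1) by (intro Min_in) auto
      moreover have jle: "j \<le> v" if "v \<in> V - {i}" for v unfolding j_def using that less.prems(1) by auto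
      ultimately have j: "j \<in> V" "i < j" "V \<inter> {i<..<j} = {}" using i(2)[of j] by force+
      have "\<exists>!D. cup_diagram (V - {i, j}) {} D"
        using card'[OF i(1) j(1,2)] less.prems by (intro less.hyps) (auto simp: ballot_empty)
      then obtain a' S' where D': "cup_diagram (V - {i, j}) {} (a', S')"
        and uniq: "\<And>D. cup_diagram (V - {i, j}) {} D \<Longrightarrow> D = (a', S')"
        by (metis surj_pair)
      show ?thesis
      proof (rule ex1I[of _ "(insert (i, j) a', S')"])
        have S': "S' = {}" using D' by (simp add: cup_diagram_def)
        have m: "matching_on V (insert (i, j) a')"
          using D' i j by (intro matching_on_insert_adjacent) (auto simp: cup_diagram_def)
        have D'': "x < y \<and> i < x \<and> j < x \<and> x \<in> V \<and> y \<in> V" if "(x, y) \<in> a'" for x y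
          using D' matching_onD[of "V - {i,j}" a' x y] that i j
          by (force simp: cup_diagram_def)
        \<comment> \<open>All other arcs lie to the right of j, so the new arc neither encloses one
          nor is enclosed.\<close>
        have "outer (insert (i, j) a') {}"
          using D' D'' j(2) unfolding outer_def cup_diagram_def fst_conv snd_conv S' 
          by (intro conjI allI impI) (simp, smt (verit) insertE not_less_iff_gr_or_eq order.strict_trans prod.inject)
        then show "cup_diagram V T (insert (i, j) a', S')"
          using m S' True by (simp add: cup_diagram_def)
      next
        fix D assume D: "cup_diagram V T D"
        obtain a S where aS: "D = (a, S)" by force
        have S: "S = {}" and m: "matching_on V a" and o: "outer a {}"
          using D True by (auto simp: aS cup_diagram_def)
        have e: "(i, j) \<in> a" by (rule cup_diagram_empty_arc[OF m o i j])
        have "cup_diagram (V - {i, j}) {} (a - {(i, j)}, S)"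
          using matching_on_remove[OF m e] outer_remove[OF o, of "(i, j)"] S by (auto simp: cup_diagram_def)
        then show "D = (insert (i, j) a', S')" using uniq e aS by force
      qed
    next
      case False
      have fT: "finite T" using TV less.prems(1) finite_subset by blast
      define j where "j = Min T"
      have j: "j \<in> T" "\<And>t. t \<in> T \<Longrightarrow> j \<le> t" using fT False by (auto simp: j_def)
      \<comment> \<open>The prefix ending in j contains one element of T, so it contains two points
        of V, and one of them lies to the left of j.\<close>
      have "2 * card (T \<inter> {..<Suc j}) \<le> card (V \<inter> {..<Suc j})"
        using less.prems(3) unfolding ballot_def by blast
      moreover have "T \<inter> {..<Suc j} = {j}" using j by force
      moreover have "V \<inter> {..<Suc j} = insert j (V \<inter> {..<j})" using j TV by auto
      ultimately have "2 \<le> card (insert j (V \<inter> {..<j}))" by simp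
      then have "V \<inter> {..<j} \<noteq> {}" by (intro notI) simp
      define i where "i = Max (V \<inter> {..<j})"
      have i': "i \<in> V \<inter> {..<j}" "\<And>v. v \<in> V \<inter> {..<j} \<Longrightarrow> v \<le> i"
        unfolding i_def using \<open>V \<inter> {..<j} \<noteq> {}\<close> less.prems(1)
        by (intro Max_in Max_ge; simp)+
      have i: "i \<in> V" "i < j" "V \<inter> {i<..<j} = {}" "i \<notin> T"
        using i' j by force+
      have jV: "j \<in> V" using j TV by auto
      have "\<exists>!D. cup_diagram (V - {i, j}) (T - {j}) D"
        using card'[OF i(1) jV i(2)] less.prems ballot_remove[OF less.prems(1,3) j i(1,2)]
        by (intro less.hyps) auto
      then obtain a' S' where D': "cup_diagram (V - {i, j}) (T - {j}) (a', S')"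
        and uniq: "\<And>D. cup_diagram (V - {i, j}) (T - {j}) D \<Longrightarrow> D = (a', S')"
        by (metis surj_pair)
      show ?thesis
      proof (rule ex1I[of _ "(insert (i, j) a', insert (i, j) S')"])
        have m: "matching_on V (insert (i, j) a')"
          using D' i j jV by (intro matching_on_insert_adjacent) (auto simp: cup_diagram_def)
        have D'': "x < y \<and> (x < i \<or> j < x) \<and> (y < i \<or> j < y) \<and> x \<in> V \<and> y \<in> V" if "(x, y) \<in> a'" for x y
        proof -
          have "x < y" "x \<in> V - {i, j}" "y \<in> V - {i, j}"
            using D' matching_onD[of "V - {i,j}" a' x y] that by (auto simp: cup_diagram_def)
          moreover have "\<not> (i < x \<and> x < j)" "\<not> (i < y \<and> y < j)"
            using i(3) calculation by auto
          ultimately show ?thesis by auto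
        qed
        have o': "outer a' S'" using D' by (simp add: cup_diagram_def)
        have "outer (insert (i, j) a') (insert (i, j) S')"
          unfolding outer_def
        proof (intro conjI allI impI)
          show "insert (i, j) S' \<subseteq> insert (i, j) a'" using o' unfolding outer_def by auto
          fix x y p q assume h: "(x, y) \<in> insert (i, j) a'" "(p, q) \<in> insert (i, j) a'" "p < x" "y < q"
          show "(x, y) \<in> insert (i, j) S'"
          proof (cases "(x, y) = (i, j)")
            case False
            then have xy: "(x, y) \<in> a'" using h by auto
            have "(p, q) \<noteq> (i, j)" using D''[OF xy] h i by auto
            then have "(p, q) \<in> a'" using h by auto
            then show ?thesis using o' h xy unfolding outer_def by blast
          qed simp
        qed
        moreover have "snd ` insert (i, j) S' = T" using D' j by (auto simp: cup_diagram_def)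
        ultimately show "cup_diagram V T (insert (i, j) a', insert (i, j) S')"
          using m by (simp add: cup_diagram_def)
      next
        fix D assume D: "cup_diagram V T D"
        obtain a S where aS: "D = (a, S)" by force
        have S: "snd ` S = T" and m: "matching_on V a" and o: "outer a S"
          using D by (auto simp: aS cup_diagram_def)
        have e: "(i, j) \<in> S" by (rule cup_diagram_adjacent_arc[OF m o S i(1,4) j(1) i(2,3)])
        have Sa: "S \<subseteq> a" using o by (simp add: outer_def)
        have "snd ` (S - {(i, j)}) = T - {j}"
        proof -
          have "s \<noteq> j" if "(r, s) \<in> S - {(i, j)}" for r s
            using that matching_on_share[OF m, of r s i j] e Sa by auto
          then show ?thesis using S by force
        qed
        then have "cup_diagram (V - {i, j}) (T - {j}) (a - {(i, j)}, S - {(i, j)})"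
          using matching_on_remove[OF m] e Sa outer_remove[OF o, of "(i, j)"] by (auto simp: cup_diagram_def)
        then show "D = (insert (i, j) a', insert (i, j) S')" using uniq e Sa aS by fastforce
      qed
    qed
  qed
qed

lemma inj_on_fst_matching:
  assumes "matching_on V a"
  shows "inj_on fst a"
proof (rule inj_onI)
  fix x y assume h: "x \<in> a" "y \<in> a" "fst x = fst y"
  obtain i j s where "x = (i, j)" "y = (i, s)" using h(3) by (metis prod.collapse)
  then show "x = y" using matching_on_share[OF assms, of i j i s] h by blast
qed

lemma inj_on_snd_matching:
  assumes "matching_on V a"
  shows "inj_on snd a"
proof (rule inj_onI)
  fix x y assume h: "x \<in> a" "y \<in> a" "snd x = snd y"
  obtain i r j where "x = (i, j)" "y = (r, j)" using h(3) by (metis prod.collapse)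
  then show "x = y" using matching_on_share[OF assms, of i j r j] h by blast
qed

lemma fst_noteq_snd_matching:
  assumes "matching_on V a" "e \<in> a" "e' \<in> a"
  shows "fst e \<noteq> snd e'"
proof
  assume eq: "fst e = snd e'"
  obtain i j r where ee: "e = (i, j)" "e' = (r, i)" using eq by (metis prod.collapse)
  then have "(i, j) \<in> a" "(r, i) \<in> a" using assms by simp_all
  then show False
    using matching_on_share[OF assms(1), of i j r i] matching_onD(1)[OF assms(1), of i j] by blast
qed

lemma card_points:
  assumes "matching_on V a" "S \<subseteq> a" "finite V"
  shows "card (fst ` S \<union> snd ` S) = 2 * card S"
proof -
  have fin: "finite S" using finite_subset[OF assms(2) finite_matching[OF assms(1,3)]] .
  have "inj_on fst S" "inj_on snd S"
    using assms(2) inj_on_fst_matching[OF assms(1)] inj_on_snd_matching[OF assms(1)] inj_on_subset by blast+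
  moreover have "fst ` S \<inter> snd ` S = {}"
    using fst_noteq_snd_matching[OF assms(1)] assms(2) by fast
  ultimately show ?thesis using fin by (simp add: card_Un_disjoint card_image)
qed

text \<open>An arc whose right endpoint is below n has its left endpoint below n as well, so each
  right endpoint accounts for two points of V.\<close>

lemma ballot_cup_diagram:
  assumes m: "matching_on V a" and S: "S \<subseteq> a" and V: "finite V"
  shows "ballot V (snd ` S)"
  unfolding ballot_def
proof (intro conjI allI)
  show "snd ` S \<subseteq> V" using S matching_onD[OF m] by force
  fix n
  let ?A = "{e \<in> S. snd e < n}"
  have A: "?A \<subseteq> a" using S by auto
  have T: "snd ` S \<inter> {..<n} = snd ` ?A" by auto
  have "card (snd ` ?A) = card ?A"
    using inj_on_subset[OF inj_on_snd_matching[OF m] A] by (rule card_image)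
  then have "2 * card (snd ` ?A) = card (fst ` ?A \<union> snd ` ?A)"
    using card_points[OF m A V] by simp
  also have "\<dots> \<le> card (V \<inter> {..<n})"
    using S V matching_onD[OF m] by (intro card_mono) force+
  finally show "2 * card (snd ` S \<inter> {..<n}) \<le> card (V \<inter> {..<n})" unfolding T .
qed

section \<open>Counting ballot sets\<close>

lemma ballot_Suc:
  "ballot {..<Suc n} T \<longleftrightarrow> ballot {..<n} (T - {n}) \<and> T \<subseteq> {..<Suc n} \<and> 2 * card T \<le> Suc n"
proof (cases "T \<subseteq> {..<Suc n}")
  case True
  have fin: "finite T" using True finite_subset by blast
  have V: "card ({..<N} \<inter> {..<m}) = min N m" for N m :: nat
    using card_lessThan[of "min N m"] by (simp add: lessThan_def Collect_conj_eq[symmetric])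
  have T1: "(T - {n}) \<inter> {..<m} = T \<inter> {..<m}" if "m \<le> n" for m using that by auto
  have T2: "(T - {n}) \<inter> {..<m} = T \<inter> {..<n}" if "n \<le> m" for m using that True by (auto simp: less_Suc_eq)
  have T3: "T \<inter> {..<m} = T" if "Suc n \<le> m" for m using that True by auto
  show ?thesis
  proof
    assume B: "ballot {..<Suc n} T"
    then have h: "2 * card (T \<inter> {..<m}) \<le> min (Suc n) m" for m unfolding ballot_def V by blast
    have "2 * card ((T - {n}) \<inter> {..<m}) \<le> min n m" for m
    proof (cases "m \<le> n")
      case True then show ?thesis using h[of m] T1[of m] by simp
    next
      case False then show ?thesis using h[of n] T2[of m] by simp
    qed
    then show "ballot {..<n} (T - {n}) \<and> T \<subseteq> {..<Suc n} \<and> 2 * card T \<le> Suc n"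
      using h[of "Suc n"] T3[of "Suc n"] True unfolding ballot_def V by (auto simp: less_Suc_eq)
  next
    assume B: "ballot {..<n} (T - {n}) \<and> T \<subseteq> {..<Suc n} \<and> 2 * card T \<le> Suc n"
    then have h: "2 * card ((T - {n}) \<inter> {..<m}) \<le> min n m" for m unfolding ballot_def V by blast
    have "2 * card (T \<inter> {..<m}) \<le> min (Suc n) m" for m
    proof (cases "m \<le> n")
      case True then show ?thesis using h[of m] T1[of m] by simp
    next
      case False then show ?thesis using B T3[of m] by simp
    qed
    then show "ballot {..<Suc n} T" using True unfolding ballot_def V by blast
  qed
qed (auto simp: ballot_def)

lemma finite_ballot: "finite {T. ballot {..<n} T}"
  by (rule finite_subset[of _ "Pow {..<n}"]) (auto simp: ballot_def)

lemma ballot_card_le: "ballot {..<n} T \<Longrightarrow> 2 * card T \<le> n"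
proof -
  assume "ballot {..<n} T"
  then have "T \<subseteq> {..<n}" "2 * card (T \<inter> {..<n}) \<le> card ({..<n} \<inter> {..<n})"
    unfolding ballot_def by blast+
  then show ?thesis by (simp add: Int_absorb2)
qed

text \<open>Pascal's rule, splitting on whether the last point belongs to T. The hypothesis admits 2
  i = n + 1, one step beyond the possible sizes, because the recursion reaches this case; both sides
  vanish there.\<close>

lemma card_ballot:
  assumes "2 * i \<le> Suc n"
  shows "int (card {T. ballot {..<n} T \<and> card T = i}) =
    int (n choose i) - (if i = 0 then 0 else int (n choose (i - 1)))"
  using assms
proof (induction n arbitrary: i)
  case 0
  then have "i = 0" by simp
  moreover have "{T. ballot {..<0} T \<and> card T = 0} = {{}}"
    by (auto simp: ballot_def)
  ultimately show ?case by simp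
next
  case (Suc n)
  let ?N = "\<lambda>n i. {T. ballot {..<n} T \<and> card T = i}"
  have fin: "finite (?N n i)" for n i
    by (rule finite_subset[OF _ finite_ballot[of n]]) auto
  show ?case
  proof (cases "2 * i = Suc (Suc n)")
    case True
    \<comment> \<open>At the boundary no ballot set is large enough, and the two binomial
      coefficients agree by symmetry.\<close>
    then have "?N (Suc n) i = {}" using ballot_card_le[of "Suc n"] by fastforce
    then have "card (?N (Suc n) i) = 0" by (simp only: card.empty)
    moreover have "Suc n choose i = Suc n choose (i - 1)"
      using True by (subst binomial_symmetric) (auto intro!: arg_cong2[of _ _ _ _ "(choose)"])
    ultimately show ?thesis using True by auto
  next
    case False
    then have i: "2 * i \<le> Suc n" using Suc.prems by simp
    show ?thesis
    proof (cases i)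
      case 0
      have "?N m 0 = {{}}" for m
      proof -
        have "T = {}" if "ballot {..<m} T" "card T = 0" for T
          using that finite_subset[of T "{..<m}"] by (auto simp: ballot_def)
        then show ?thesis by (auto simp: ballot_empty)
      qed
      then have "card (?N (Suc n) i) = 1" using 0 by (metis One_nat_def card_1_singleton_iff)
      then show ?thesis using 0 by simp
    next
      case (Suc l)
      have fT: "finite T" if "ballot {..<m} T" for m T
        using that finite_subset[of T "{..<m}"] by (auto simp: ballot_def)
      have nT: "n \<notin> T" if "ballot {..<n} T" for T using that by (auto simp: ballot_def)
      have "?N (Suc n) i = ?N n i \<union> insert n ` ?N n l"
      proof (intro equalityI subsetI)
        fix T assume "T \<in> ?N (Suc n) i"
        then have T: "ballot {..<n} (T - {n})" "card T = i" "finite T"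
          using fT[of "Suc n" T] by (auto simp: ballot_Suc[of n])
        show "T \<in> ?N n i \<union> insert n ` ?N n l"
        proof (cases "n \<in> T")
          case True
          then have "T = insert n (T - {n})" "card (T - {n}) = l" using T Suc by auto
          then show ?thesis using T by blast
        qed (use T in simp)
      next
        fix T assume "T \<in> ?N n i \<union> insert n ` ?N n l"
        then show "T \<in> ?N (Suc n) i"
        proof
          assume "T \<in> ?N n i"
          then show ?thesis using nT i by (auto simp: ballot_Suc[of n]) (auto simp: ballot_def)
        next
          assume "T \<in> insert n ` ?N n l"
          then obtain T' where T': "T = insert n T'" "ballot {..<n} T'" "card T' = l" by auto
          have "card T = i" using T' nT fT Suc by auto
          then show ?thesis using T' nT i by (auto simp: ballot_Suc[of n]) (auto simp: ballot_def)
        qed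
      qed
      moreover have "?N n i \<inter> insert n ` ?N n l = {}" using nT by auto
      moreover have "card (insert n ` ?N n l) = card (?N n l)"
        by (rule card_image, rule inj_onI) (use nT in \<open>metis (mono_tags, lifting) Diff_insert_absorb mem_Collect_eq\<close>)
      ultimately have "card (?N (Suc n) i) = card (?N n i) + card (?N n l)"
        using fin by (simp add: card_Un_disjoint)
      moreover have "2 * l \<le> Suc n" using i Suc by simp
      ultimately show ?thesis using Suc.IH[OF i] Suc.IH[of l] Suc
        by (cases l) auto
    qed
  qed
qed


section \<open>Unnesting two nested arcs\<close>

text \<open>By \<open>min\<close>, the arc (p, q) is the innermost one around (i, j). An arc
  strictly between the two would cross both of the new arcs (p, i) and (j, q).\<close>

lemma matching_on_unnest:
  assumes m: "matching_on V a" and ij: "(i, j) \<in> a" and pq: "(p, q) \<in> a" and "p < i" "j < q"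
    and min: "\<And>r s. (r, s) \<in> a \<Longrightarrow> r < i \<Longrightarrow> j < s \<Longrightarrow> r \<le> p"
  shows "matching_on V (insert (p, i) (insert (j, q) (a - {(i, j), (p, q)})))"
    (is "matching_on V ?c")
proof (rule matching_onI)
  note D = matching_onD[OF m]
  have lt: "i < j" "p < q" using D ij pq by auto
  show "x < y \<and> x \<in> V \<and> y \<in> V" if "(x, y) \<in> ?c" for x y
    using that D ij pq assms(4,5) by auto
  show "\<exists>r s. (r, s) \<in> ?c \<and> (x = r \<or> x = s)" if "x \<in> V" for x
  proof -
    obtain r s where rs: "(r, s) \<in> a" "x = r \<or> x = s" using matching_on_cover[OF m \<open>x \<in> V\<close>] .
    show ?thesis
    proof (cases "(r, s) = (i, j) \<or> (r, s) = (p, q)")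
      case True then show ?thesis using rs(2) by blast
    next
      case False then show ?thesis using rs by blast
    qed
  qed
  have sep: "x \<noteq> i \<and> x \<noteq> j \<and> x \<noteq> p \<and> x \<noteq> q \<and> y \<noteq> i \<and> y \<noteq> j \<and> y \<noteq> p \<and> y \<noteq> q"
    if "(x, y) \<in> a - {(i, j), (p, q)}" for x y
    using that matching_on_share[OF m, of x y i j] matching_on_share[OF m, of x y p q] ij pq by blast
  show "x = r \<and> y = s" if "(x, y) \<in> ?c" "(r, s) \<in> ?c" "x = r \<or> x = s \<or> y = r \<or> y = s" for x y r s
  proof (cases "(x, y) \<in> a - {(i, j), (p, q)}")
    case True
    show ?thesis
    proof (cases "(r, s) \<in> a - {(i, j), (p, q)}")
      case t: True
      show ?thesis using matching_on_share[OF m, of x y r s] True t that(3) by blast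
    next
      case False
      then have "(r, s) = (p, i) \<or> (r, s) = (j, q)" using that by blast
      then show ?thesis using sep[OF True] that(3) by auto
    qed
  next
    case False
    then have xy: "(x, y) = (p, i) \<or> (x, y) = (j, q)" using that by blast
    show ?thesis
    proof (cases "(r, s) \<in> a - {(i, j), (p, q)}")
      case True
      show ?thesis using sep[OF True] that(3) xy by auto
    next
      case False
      then have "(r, s) = (p, i) \<or> (r, s) = (j, q)" using that by blast
      then show ?thesis using xy that(3) assms(4,5) lt by auto
    qed
  qed
  have nc: "\<not> (p < x \<and> x < i \<and> i < y) \<and> \<not> (j < x \<and> x < q \<and> q < y) \<and>
    \<not> (x < p \<and> p < y \<and> y < i) \<and> \<not> (x < j \<and> j < y \<and> y < q)"
    if xy: "(x, y) \<in> a - {(i, j), (p, q)}" for x y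
  proof -
    have xya: "(x, y) \<in> a" using xy by simp
    note N = matching_on_noncrossing[OF m]
    note s = sep[OF xy]
    show ?thesis
    proof (intro conjI notI)
      assume h: "p < x \<and> x < i \<and> i < y"
      then have "j < y" using N[OF xya ij] s by auto
      then show False using min[OF xya] h by auto
    next
      assume "j < x \<and> x < q \<and> q < y"
      then show False using N[OF pq xya] assms(4) lt by auto
    next
      assume "x < p \<and> p < y \<and> y < i"
      then show False using N[OF xya pq] assms(5) lt by auto
    next
      assume h: "x < j \<and> j < y \<and> y < q"
      show False
      proof (cases "x < i")
        case True
        then have "x < p" using min[OF xya] h s by auto
        then show False using N[OF xya pq] h assms(4) lt by auto
      next
        case False
        then show False using N[OF ij xya] h s by auto
      qed
    qed
  qed
  show False if "(x, y) \<in> ?c" "(r, s) \<in> ?c" "x < r" "r < y" "y < s" for x y r s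
  proof (cases "(x, y) \<in> a - {(i, j), (p, q)}")
    case True
    show ?thesis
    proof (cases "(r, s) \<in> a - {(i, j), (p, q)}")
      case t: True
      show ?thesis using matching_on_noncrossing[OF m, of x y r s] True t that(3-) by blast
    next
      case False
      then have "(r, s) = (p, i) \<or> (r, s) = (j, q)" using that by blast
      then show ?thesis using nc[OF True] that(3-) by auto
    qed
  next
    case False
    then have xy: "(x, y) = (p, i) \<or> (x, y) = (j, q)" using that by blast
    show ?thesis
    proof (cases "(r, s) \<in> a - {(i, j), (p, q)}")
      case True
      show ?thesis using nc[OF True] that(3-) xy by auto
    next
      case False
      then have "(r, s) = (p, i) \<or> (r, s) = (j, q)" using that by blast
      then show ?thesis using xy that(3-) assms(4,5) lt by auto
    qed
  qed
qed

lemma ex_unnest: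
  assumes m: "matching_on V a" and V: "finite V" and ij: "(i, j) \<in> a" and xy: "(x, y) \<in> a" "x < i" "j < y"
  obtains p q where "(p, q) \<in> a" "p < i" "j < q"
    "matching_on V (insert (p, i) (insert (j, q) (a - {(i, j), (p, q)})))"
proof -
  \<comment> \<open>Among the arcs enclosing (i, j), the innermost is the one with the largest left
    endpoint.\<close>
  define P where "P = {r. r < i \<and> (\<exists>s. (r, s) \<in> a \<and> j < s)}"
  have "finite P" by (rule finite_subset[of _ "{..<i}"]) (auto simp: P_def)
  moreover have "x \<in> P" using xy by (auto simp: P_def)
  ultimately have "Max P \<in> P" and max: "\<And>r. r \<in> P \<Longrightarrow> r \<le> Max P" by (auto intro: Max_in)
  then obtain q where q: "(Max P, q) \<in> a" "Max P < i" "j < q" by (auto simp: P_def)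
  show ?thesis
    by (rule that[OF q matching_on_unnest[OF m ij q]], rule max) (auto simp: P_def)
qed

text \<open>Let (i, j) outside S lie under (p, q). If (p, q) is outside S too, the first relation
  passes to the unnested matching c. Otherwise the second relation expresses the coefficient by
  three others in which the label of (p, q) has moved to a shorter arc. Unnesting shortens a by 2 (j
  - i), so the total length of a and S together decreases in every case.\<close>

lemma vanish_if_vanish_outer:
  fixes Z :: "matching \<Rightarrow> matching \<Rightarrow> int"
  assumes V: "finite V"
    and outer: "\<And>a S. matching_on V a \<Longrightarrow> outer a S \<Longrightarrow> Z a S = 0"
    and unnest: "\<And>a c a0 i j p q S. \<lbrakk>matching_on V a; matching_on V c; p < i; i < j; j < q;
      a = insert (i, j) (insert (p, q) a0); c = insert (p, i) (insert (j, q) a0);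
      (i, j) \<notin> a0; (p, q) \<notin> a0; (p, i) \<notin> a0; (j, q) \<notin> a0; S \<subseteq> a0\<rbrakk> \<Longrightarrow> 
      Z a S = Z c S \<and>
      Z a (insert (i, j) S) + Z a (insert (p, q) S) = Z c (insert (p, i) S) + Z c (insert (j, q) S)"
    and "matching_on V a" "S \<subseteq> a"
  shows "Z a S = 0"
  using assms(4,5)
proof (induction "(\<Sum>(x, y)\<in>S. y - x) + (\<Sum>(x, y)\<in>a. y - x)" arbitrary: a S rule: less_induct)
  case less
  note m = less.prems(1)
  show ?case
  proof (cases "outer a S")
    case False
    then obtain i j x y where ij: "(i, j) \<in> a" "(i, j) \<notin> S" and xy: "(x, y) \<in> a" "x < i" "j < y"
      using less.prems unfolding outer_def by blast
    obtain p q where pq: "(p, q) \<in> a" "p < i" "j < q"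
      and c': "matching_on V (insert (p, i) (insert (j, q) (a - {(i, j), (p, q)})))"
      using ex_unnest[OF m V ij(1) xy] .
    define a0 where "a0 = a - {(i, j), (p, q)}"
    define c where "c = insert (p, i) (insert (j, q) a0)"
    have lt: "i < j" using matching_onD[OF m] ij by auto
    have a: "a = insert (i, j) (insert (p, q) a0)" using ij pq by (auto simp: a0_def)
    have c: "matching_on V c" using c' by (simp add: c_def a0_def)
    have new: "(i, j) \<notin> a0" "(p, q) \<notin> a0" "(p, i) \<notin> a0" "(j, q) \<notin> a0"
      using matching_on_share[OF m, of p i p q] matching_on_share[OF m, of j q p q] lt pq
      by (auto simp: a0_def)
    note rel = unnest[OF m c pq(2) lt pq(3) a c_def new]
    have fin: "finite a0" using finite_matching[OF m V] by (simp add: a0_def)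
    have len: "(\<Sum>(x, y)\<in>c. y - x) < (\<Sum>(x, y)\<in>a. y - x)"
      unfolding a c_def using fin new lt pq by simp
    show ?thesis
    proof (cases "(p, q) \<in> S")
      case False
      then have S: "S \<subseteq> a0" using less.prems ij by (auto simp: a0_def)
      have "Z c S = 0" using S len c by (intro less.hyps) (auto simp: c_def)
      then show ?thesis using rel[OF S] by simp
    next
      case True
      define S0 where "S0 = S - {(p, q)}"
      have S: "S = insert (p, q) S0" and S0: "S0 \<subseteq> a0" using True ij less.prems by (auto simp: S0_def a0_def)
      have finS: "finite S0" using finite_subset[OF S0 fin] .
      have nS: "(i, j) \<notin> S0" "(p, q) \<notin> S0" "(p, i) \<notin> S0" "(j, q) \<notin> S0" using new S0 by auto
      have lenS: "(\<Sum>(x, y)\<in>insert e S0. y - x) < (\<Sum>(x, y)\<in>S. y - x)"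
        if "e \<in> {(i, j), (p, i), (j, q)}" for e
        unfolding S using finS nS lt pq that by auto
      have "Z a (insert (i, j) S0) = 0"
        using S0 lenS ij a by (intro less.hyps m) auto
      moreover have "Z c (insert (p, i) S0) = 0"
        using S0 by (intro less.hyps c add_strict_mono lenS len) (auto simp: c_def)
      moreover have "Z c (insert (j, q) S0) = 0"
        using S0 by (intro less.hyps c add_strict_mono lenS len) (auto simp: c_def)
      ultimately show ?thesis using rel[OF S0] S by simp
    qed
  qed (use outer m in blast)
qed

section \<open>Products with a diagonal factor\<close>

lemma circle_of_self: "p \<in> circle_of E p"
  by (simp add: circle_of_def)

lemma circle_of_eqI:
  assumes "p \<in> K" "\<And>x y. (x, y) \<in> E \<Longrightarrow> x \<in> K \<longleftrightarrow> y \<in> K"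
    and "\<And>y. y \<in> K \<Longrightarrow> (p, y) \<in> (E \<union> E\<inverse>)\<^sup>*"
  shows "circle_of E p = K"
proof
  have "y \<in> K" if "(p, y) \<in> (E \<union> E\<inverse>)\<^sup>*" for y
    using that by induction (use assms in auto)
  then show "circle_of E p \<subseteq> K" by (auto simp: circle_of_def)
  show "K \<subseteq> circle_of E p" using assms(3) by (auto simp: circle_of_def)
qed

lemma circle_of_eq:
  assumes "q \<in> circle_of E p"
  shows "circle_of E q = circle_of E p"
proof -
  have "sym ((E \<union> E\<inverse>)\<^sup>*)" by (intro sym_rtrancl) (auto simp: sym_def)
  then show ?thesis
    using assms unfolding circle_of_def
    by (auto dest: symD intro: rtrancl_trans)
qed

lemma circle_of_edge:
  assumes "(x, y) \<in> E"
  shows "x \<in> circle_of E p \<longleftrightarrow> y \<in> circle_of E p"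
proof -
  have "(x, y) \<in> E \<union> E\<inverse>" "(y, x) \<in> E \<union> E\<inverse>" using assms by auto
  then show ?thesis unfolding circle_of_def by (auto intro: rtrancl_into_rtrancl)
qed

lemma in_circlesD:
  assumes "C \<in> circles V E" "p \<in> C"
  shows "C = circle_of E p"
  using assms circle_of_eq unfolding circles_def by fastforce

abbreviation points :: "matching \<Rightarrow> nat set" where
  "points T \<equiv> fst ` T \<union> snd ` T"

lemma points_matching: "matching_on V b \<Longrightarrow> points b = V"
proof
  assume m: "matching_on V b"
  show "points b \<subseteq> V" using matching_onD[OF m] by force
  show "V \<subseteq> points b"
  proof
    fix p assume "p \<in> V"
    then obtain r s where rs: "(r, s) \<in> b" "p = r \<or> p = s" using matching_on_cover[OF m] by metis
    from rs(1) have "r \<in> points b" "s \<in> points b" by force+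
    then show "p \<in> points b" using rs(2) by blast
  qed
qed

lemma W_circles_subset:
  assumes "matching_on {..<2 * k} a" "matching_on {..<2 * k} b" "C \<in> W_circles k b a"
  shows "C \<subseteq> {..<2 * k}"
proof -
  obtain p where p: "p < 2 * k" "C = circle_of (a \<union> b) p" using assms(3) by (auto simp: W_circles_def circles_def)
  have "y < 2 * k" if "(p, y) \<in> ((a \<union> b) \<union> (a \<union> b)\<inverse>)\<^sup>*" for y
    using that by induction (use p matching_onD[OF assms(1)] matching_onD[OF assms(2)] in auto)
  then show ?thesis using p by (auto simp: circle_of_def)
qed

text \<open>The exponent of X collected on C: its own label, and one for each two-point circle of
  W(b)b labelled X that was merged into it. One endpoint is tested, since both ends of an arc of b
  lie on the same circle. Exponents above 1 are kept in order to detect X^2 = 0.\<close>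

definition merged_count :: "matching \<Rightarrow> (nat set \<Rightarrow> frob) \<Rightarrow> (nat set \<Rightarrow> frob) \<Rightarrow> nat set \<Rightarrow> nat" where
  "merged_count T g f C = of_bool (f C = X) + card {e \<in> T. fst e \<in> C \<and> g {fst e, snd e} = X}"

definition label_of_count :: "nat \<Rightarrow> frob" where
  "label_of_count n = (if n = 0 then One else X)"

lemma frob_mult_label:
  "frob_mult x y = (let n = (of_bool (x = X) + of_bool (y = X) :: nat) in
    if n \<le> 1 then frag_of (label_of_count n) else 0)"
  by (cases x; cases y) (auto simp: label_of_count_def)

text \<open>Insertions commute when the keys differ, so the fold is interpreted on A, where f is
  injective. For a matching, f will be \<open>fst\<close>.\<close>

lemma sorted_key_list_of_set_inj_on:
  assumes "finite A" "inj_on f A"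
  shows "set (sorted_key_list_of_set f A) = A \<and> distinct (sorted_key_list_of_set f A)"
proof -
  interpret folding_on A "insort_key f" "[]"
  proof
    show "insort_key f y \<circ> insort_key f x = insort_key f x \<circ> insort_key f y" if "x \<in> A" "y \<in> A" for x y
    proof (cases "x = y")
      case False
      then have "f x \<noteq> f y" using that assms(2) by (auto dest: inj_onD)
      then show ?thesis by (simp add: fun_eq_iff insort_key_left_comm)
    qed simp
  qed
  have "set (F B) = B \<and> distinct (F B)" if "finite B" "B \<subseteq> A" for B
    using that by induction (simp_all add: set_insort_key distinct_insort)
  then show ?thesis using assms(1) by (simp add: sorted_key_list_of_set_def)
qed

text \<open>
  In a product with a factor in \<open>\<F>(W(b)b)\<close>, every saddle merges a two-point circle of \<open>W(b)b\<close> into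
  a circle of the other factor. \<open>R\<close> embeds the line carrying \<open>W(b)b\<close> and \<open>L\<close> the other line, which
  carries \<open>m\<close> and \<open>b\<close>.
\<close>

locale merging =
  fixes k :: nat and d b a m :: matching and L R :: "nat \<Rightarrow> point2"
  assumes b: "matching_on {..<2 * k} b" and m: "matching_on {..<2 * k} m"
    and sides: "L = Inl \<and> R = Inr \<and> d = b \<and> a = m \<or> L = Inr \<and> R = Inl \<and> a = b \<and> d = m"
begin

abbreviation "E \<equiv> stage_arcs d b a"
abbreviation "M \<equiv> circle_of (m \<union> b)"
abbreviation "W \<equiv> circles {..<2 * k} (m \<union> b)"

lemma LR [simp]: "L x = L y \<longleftrightarrow> x = y" "R x = R y \<longleftrightarrow> x = y" "L x \<noteq> R y" "R y \<noteq> L x"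
  using sides by auto

lemma mem_sides: "L x \<in> L ` A \<union> R ` B \<longleftrightarrow> x \<in> A" "R x \<in> L ` A \<union> R ` B \<longleftrightarrow> x \<in> B"
  by auto

text \<open>Vertical segments are always directed from \<open>Inl\<close> to \<open>Inr\<close>,
  while L may be either embedding; hence both orientations in the last case.\<close>

lemma edge_cases:
  assumes "(u, v) \<in> E T"
  obtains x y where "u = L x" "v = L y" "(x, y) \<in> m \<union> (b - T)"
  | x y where "u = R x" "v = R y" "(x, y) \<in> b"
  | x where "x \<in> points T" "u = L x \<and> v = R x \<or> u = R x \<and> v = L x"
proof -
  have "E T = map_prod L L ` (m \<union> (b - T)) \<union> map_prod R R ` (b \<union> (b - T)) \<union>
     (\<Union>(i, j) \<in> T. {(Inl i, Inr i), (Inl j, Inr j)})"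
    using sides by (auto simp: stage_arcs_def)
  then consider x y where "u = L x" "v = L y" "(x, y) \<in> m \<union> (b - T)"
    | x y where "u = R x" "v = R y" "(x, y) \<in> b"
    | i j where "(i, j) \<in> T" "(u, v) = (Inl i, Inr i) \<or> (u, v) = (Inl j, Inr j)"
    using assms by auto
  then show ?thesis
  proof cases
    case (3 i j)
    then have "i \<in> points T" "j \<in> points T" by force+
    then show ?thesis using 3(2) sides that(3) by auto
  qed (use that in auto)
qed

lemma edgeL: "(x, y) \<in> m \<or> (x, y) \<in> b \<and> (x, y) \<notin> T \<Longrightarrow> (L x, L y) \<in> E T"
  using sides unfolding stage_arcs_def by force

lemma edgeR: "(x, y) \<in> b \<Longrightarrow> (R x, R y) \<in> E T"
  using sides unfolding stage_arcs_def by force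

lemma edgeLR:
  assumes "x \<in> points T"
  shows "(L x, R x) \<in> E T \<union> (E T)\<inverse>" "(R x, L x) \<in> E T \<union> (E T)\<inverse>"
  using sides assms unfolding stage_arcs_def by force+

lemma points_iff:
  assumes "T \<subseteq> b" "(x, y) \<in> b"
  shows "x \<in> points T \<longleftrightarrow> (x, y) \<in> T" "y \<in> points T \<longleftrightarrow> (x, y) \<in> T"
proof -
  have sh: "(r, s) = (x, y)" if "(r, s) \<in> T" "x = r \<or> x = s \<or> y = r \<or> y = s" for r s
    using matching_on_share[OF b assms(2), of r s] that assms(1) by blast
  show "x \<in> points T \<longleftrightarrow> (x, y) \<in> T" "y \<in> points T \<longleftrightarrow> (x, y) \<in> T"
  proof -
    have "(x, y) \<in> T \<Longrightarrow> x \<in> points T \<and> y \<in> points T" by force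
    moreover have "z \<in> points T \<Longrightarrow> \<exists>r s. (r, s) \<in> T \<and> (z = r \<or> z = s)" for z by force
    ultimately show "x \<in> points T \<longleftrightarrow> (x, y) \<in> T" "y \<in> points T \<longleftrightarrow> (x, y) \<in> T"
      using sh by metis+
  qed
qed

text \<open>A saddle at (r, s) cuts this arc of b on the L side, but the path from L r through R r
  and R s to L s replaces it, along the copy of the arc that remains on the R side. So at every
  stage the L points are divided as in the circles of \<open>m \<union> b\<close>, and only R points
  of arcs in T are added.\<close>

lemma circle_L:
  assumes "T \<subseteq> b"
  shows "circle_of (E T) (L p) = L ` M p \<union> R ` (M p \<inter> points T)"
proof (rule circle_of_eqI)
  let ?K = "L ` M p \<union> R ` (M p \<inter> points T)"
  have LK: "L x \<in> ?K \<longleftrightarrow> x \<in> M p" and RK: "R x \<in> ?K \<longleftrightarrow> x \<in> M p \<and> x \<in> points T" for x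
    by (simp_all only: mem_sides Int_iff)
  show "L p \<in> ?K" using circle_of_self LK by metis
  show "u \<in> ?K \<longleftrightarrow> v \<in> ?K" if "(u, v) \<in> E T" for u v
    using that
  proof (cases rule: edge_cases)
    case (1 x y)
    then show ?thesis using circle_of_edge[of x y "m \<union> b" p] LK by auto
  next
    case (2 x y)
    then show ?thesis using circle_of_edge[of x y "m \<union> b" p] RK points_iff[OF assms, of x y] by auto
  next
    case (3 x)
    then show ?thesis using LK RK by auto
  qed
  have L: "(L p, L y) \<in> (E T \<union> (E T)\<inverse>)\<^sup>*" if "y \<in> M p" for y
  proof -
    have "(p, y) \<in> ((m \<union> b) \<union> (m \<union> b)\<inverse>)\<^sup>*" using that by (simp add: circle_of_def)
    then show ?thesis
    proof induction
      case (step y z)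
      have path: "(L r, L s) \<in> (E T \<union> (E T)\<inverse>)\<^sup>* \<and> (L s, L r) \<in> (E T \<union> (E T)\<inverse>)\<^sup>*"
        if rs: "(r, s) \<in> m \<union> b" for r s
      proof (cases "(r, s) \<in> m \<or> (r, s) \<notin> T")
        case True
        then have "(L r, L s) \<in> E T" using rs by (intro edgeL) auto
        then show ?thesis by auto
      next
        case False
        then have "r \<in> points T" "s \<in> points T" by force+
        note v = edgeLR[OF this(1)] edgeLR[OF this(2)]
        have "(R r, R s) \<in> E T" using rs False by (intro edgeR) auto
        then have h: "(R r, R s) \<in> E T \<union> (E T)\<inverse>" "(R s, R r) \<in> E T \<union> (E T)\<inverse>" by auto
        have "(L r, L s) \<in> (E T \<union> (E T)\<inverse>)\<^sup>*"
          using v(1) h(1) v(4) by (meson converse_rtrancl_into_rtrancl r_into_rtrancl)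
        moreover have "(L s, L r) \<in> (E T \<union> (E T)\<inverse>)\<^sup>*"
          using v(3) h(2) v(2) by (meson converse_rtrancl_into_rtrancl r_into_rtrancl)
        ultimately show ?thesis by simp
      qed
      have "(y, z) \<in> m \<union> b \<or> (z, y) \<in> m \<union> b" using step.hyps by blast
      then have "(L y, L z) \<in> (E T \<union> (E T)\<inverse>)\<^sup>*" using path by blast
      then show ?case using step.IH by (rule rtrancl_trans[rotated])
    qed simp
  qed
  show "(L p, u) \<in> (E T \<union> (E T)\<inverse>)\<^sup>*" if "u \<in> ?K" for u
  proof -
    from that consider y where "u = L y" "y \<in> M p" | y where "u = R y" "y \<in> M p" "y \<in> points T" by blast
    then show ?thesis
    proof cases
      case 2
      then show ?thesis using L[of y] edgeLR(1)[of y T] by (meson rtrancl_into_rtrancl)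
    qed (use L in simp)
  qed
qed

lemma circle_R:
  assumes "T \<subseteq> b" "(i, j) \<in> b" "(i, j) \<notin> T" "x = i \<or> x = j"
  shows "circle_of (E T) (R x) = {R i, R j}"
proof (rule circle_of_eqI)
  show "R x \<in> {R i, R j}" using assms by auto
  have no: "i \<notin> points T" "j \<notin> points T" using points_iff[OF assms(1,2)] assms(3) by auto
  show "u \<in> {R i, R j} \<longleftrightarrow> v \<in> {R i, R j}" if "(u, v) \<in> E T" for u v
    using that
  proof (cases rule: edge_cases)
    case (2 r s)
    then have "r = i \<or> r = j \<longleftrightarrow> s = i \<or> s = j" using matching_on_share[OF b assms(2), of r s] by blast
    then show ?thesis using 2 by simp
  next
    case (3 y)
    then have "y \<noteq> i" "y \<noteq> j" using no by blast+
    then show ?thesis using 3(2) by auto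
  qed auto
  have "(R i, R j) \<in> E T" using edgeR[OF assms(2)] .
  then show "(R x, y) \<in> (E T \<union> (E T)\<inverse>)\<^sup>*" if "y \<in> {R i, R j}" for y
    using that assms(4) by auto
qed

lemma circle_R_eq_L:
  assumes "x \<in> points T"
  shows "circle_of (E T) (R x) = circle_of (E T) (L x)"
  by (rule circle_of_eq) (use edgeLR(1)[OF assms] in \<open>auto simp: circle_of_def\<close>)

text \<open>An R point of an arc in T contributes no circle of its own, because a vertical segment
  ties it to the L side; the other R points still lie on untouched two-point circles.\<close>

lemma stage_circles_eq:
  assumes "T \<subseteq> b"
  shows "stage_circles k d b a T =
    (\<lambda>C. L ` C \<union> R ` (C \<inter> points T)) ` W \<union> (\<lambda>(i, j). {R i, R j}) ` (b - T)"
proof -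
  let ?V = "{..<2 * k}"
  have "?V <+> ?V = L ` ?V \<union> R ` ?V" using sides by (auto simp: Plus_def)
  then have "stage_circles k d b a T = circle_of (E T) ` (L ` ?V) \<union> circle_of (E T) ` (R ` ?V)"
    by (simp add: stage_circles_def circles_def image_Un)
  also have "circle_of (E T) ` (L ` ?V) = (\<lambda>C. L ` C \<union> R ` (C \<inter> points T)) ` W"
    by (simp add: circles_def image_image circle_L[OF assms])
  also have "\<dots> \<union> circle_of (E T) ` (R ` ?V) = \<dots> \<union> (\<lambda>(i, j). {R i, R j}) ` (b - T)" (is "?A \<union> ?B = ?A \<union> ?C")
  proof -
    have BAC: "?B \<subseteq> ?A \<union> ?C"
    proof
      fix Z assume "Z \<in> ?B"
      then obtain x where x: "x < 2 * k" "Z = circle_of (E T) (R x)" by auto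
      then have "x \<in> ?V" by simp
      then obtain i j where ij: "(i, j) \<in> b" "x = i \<or> x = j" using matching_on_cover[OF b] by metis
      show "Z \<in> ?A \<union> ?C"
      proof (cases "(i, j) \<in> T")
        case True
        then have "x \<in> points T" using ij by force
        then have "Z = L ` M x \<union> R ` (M x \<inter> points T)" using x circle_R_eq_L circle_L[OF assms] by simp
        then show ?thesis using x by (auto simp: circles_def)
      next
        case False
        then have "Z = (\<lambda>(i, j). {R i, R j}) (i, j)" using circle_R[OF assms ij(1) False ij(2)] x by simp
        then show ?thesis using ij(1) False by blast
      qed
    qed
    have CB: "?C \<subseteq> ?B"
    proof
      fix Z assume "Z \<in> ?C"
      then obtain i j where ij: "(i, j) \<in> b" "(i, j) \<notin> T" "Z = {R i, R j}" by auto
      then have "Z = circle_of (E T) (R i)" using circle_R[OF assms ij(1,2)] by simp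
      then show "Z \<in> ?B" using matching_onD[OF b ij(1)] by auto
    qed
    show ?thesis
      by (rule equalityI[OF Un_least[OF Un_upper1 BAC] Un_least[OF Un_upper1 le_supI2[OF CB]]])
  qed
  finally show ?thesis .
qed

definition stage_label :: "(nat set \<Rightarrow> frob) \<Rightarrow> (nat set \<Rightarrow> frob) \<Rightarrow> matching \<Rightarrow> point2 set \<Rightarrow> frob" where
  "stage_label g f T = (\<lambda>Z \<in> stage_circles k d b a T.
     if Z \<subseteq> range R then g (R -` Z) else label_of_count (merged_count T g f (L -` Z)))"

text \<open>The invariant of the sequence of saddles: a closed form of the state after those at T,
  whatever their order. It is zero once some circle has collected X twice.\<close>

definition stage_state :: "(nat set \<Rightarrow> frob) \<Rightarrow> (nat set \<Rightarrow> frob) \<Rightarrow> matching \<Rightarrow> (point2 set \<Rightarrow> frob) \<Rightarrow>\<^sub>0 int" where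
  "stage_state g f T = (if \<forall>C \<in> W. merged_count T g f C \<le> 1 then frag_of (stage_label g f T) else 0)"

lemma W_nonempty: "C \<in> W \<Longrightarrow> \<exists>x. x \<in> C"
  using circle_of_self by (fastforce simp: circles_def)

lemma vimage_circle:
  "L -` (L ` C \<union> R ` D) = C" "R -` {R i, R j} = {i, j}" "x \<in> C \<Longrightarrow> \<not> L ` C \<union> R ` D \<subseteq> range R"
  "{R i, R j} \<subseteq> range R"
  by auto

lemma stage_label_L:
  assumes "T \<subseteq> b" "C \<in> W"
  shows "stage_label g f T (L ` C \<union> R ` (C \<inter> points T)) = label_of_count (merged_count T g f C)"
proof -
  obtain x where "x \<in> C" using W_nonempty assms by blast
  have "L ` C \<union> R ` (C \<inter> points T) \<in> stage_circles k d b a T"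
    using assms by (simp add: stage_circles_eq)
  then show ?thesis
    by (simp only: stage_label_def restrict_apply' if_not_P[OF vimage_circle(3)[OF \<open>x \<in> C\<close>]] vimage_circle(1))
qed

lemma stage_label_R:
  assumes "T \<subseteq> b" "(i, j) \<in> b" "(i, j) \<notin> T"
  shows "stage_label g f T {R i, R j} = g {i, j}"
proof -
  have "{R i, R j} \<in> stage_circles k d b a T"
    using assms by (force simp: stage_circles_eq)
  then show ?thesis
    unfolding stage_label_def using vimage_circle(2,4) by simp
qed

lemma merged_count_insert:
  assumes "finite T" "(i, j) \<notin> T"
  shows "merged_count (insert (i, j) T) g f C = merged_count T g f C + of_bool (i \<in> C \<and> g {i, j} = X)"
proof -
  have "{e \<in> insert (i, j) T. fst e \<in> C \<and> g {fst e, snd e} = X} =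
    (if i \<in> C \<and> g {i, j} = X then insert (i, j) {e \<in> T. fst e \<in> C \<and> g {fst e, snd e} = X}
     else {e \<in> T. fst e \<in> C \<and> g {fst e, snd e} = X})" by auto
  then show ?thesis using assms by (auto simp: merged_count_def)
qed

lemma M_arc:
  assumes "(i, j) \<in> b" "C \<in> W"
  shows "i \<in> C \<longleftrightarrow> C = M i" "j \<in> C \<longleftrightarrow> C = M i"
proof -
  show i: "i \<in> C \<longleftrightarrow> C = M i" using in_circlesD[OF assms(2)] circle_of_self by metis
  show "j \<in> C \<longleftrightarrow> C = M i"
    using i circle_of_edge[of i j "m \<union> b"] assms circle_of_self by (metis (no_types, lifting) UnI2 in_circlesD)
qed

text \<open>The circle through L i contains a point of the L side and {R i, R j} does not, so the
  saddle is a merge and the exponents of X add. All other circles and their counts are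
  unchanged.\<close>

lemma saddle_stage_label:
  assumes T: "T \<subseteq> b" and e: "(i, j) \<in> b" "(i, j) \<notin> T"
    and le: "\<forall>C \<in> W. merged_count T g f C \<le> 1"
  shows "saddle k d b a T (i, j) (stage_label g f T) = stage_state g f (insert (i, j) T)"
proof -
  let ?T = "insert (i, j) T"
  let ?l = "stage_label g f T"
  have fin: "finite T" using T finite_subset finite_matching[OF b] by blast
  have T': "?T \<subseteq> b" using T e by auto
  have iW: "M i \<in> W" using matching_onD[OF b e(1)] by (auto simp: circles_def)
  define CL where "CL = L ` M i \<union> R ` (M i \<inter> points T)"
  define C' where "C' = L ` M i \<union> R ` (M i \<inter> points ?T)"
  have cL: "circle_of (E T) (L i) = CL" using circle_L[OF T] by (simp add: CL_def)
  have cR: "circle_of (E T) (R i) = {R i, R j}" using circle_R[OF T e] by simp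
  have c'L: "circle_of (E ?T) (L i) = C'" using circle_L[OF T'] by (simp add: C'_def)
  have c'R: "circle_of (E ?T) (R i) = C'" using circle_R_eq_L[of i ?T] c'L by simp
  have "L i \<in> CL" using circle_of_self[of i "m \<union> b"] by (auto simp: CL_def)
  then have "CL \<noteq> {R i, R j}" by auto
  let ?F = "\<lambda>x. frag_of (restrict (?l(C' := x)) (stage_circles k d b a ?T))"
  \<comment> \<open>\<open>saddle\<close> multiplies the label at \<open>Inl i\<close> by the one at
    \<open>Inr i\<close>; when L is \<open>Inr\<close>, the factors appear in the opposite
    order.\<close>
  have mult_comm: "frob_mult x y = frob_mult y x" for x y by (cases x; cases y) auto
  have "saddle k d b a T (i, j) ?l = frag_extend ?F (frob_mult (?l CL) (?l {R i, R j}))"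
    using sides
  proof
    assume "L = Inl \<and> R = Inr \<and> d = b \<and> a = m"
    then show ?thesis using cL cR c'L \<open>CL \<noteq> {R i, R j}\<close> by (simp add: saddle_def Let_def)
  next
    assume "L = Inr \<and> R = Inl \<and> a = b \<and> d = m"
    then show ?thesis
      unfolding mult_comm[of "?l CL" "?l {R i, R j}"]
      using cL cR c'R \<open>CL \<noteq> {R i, R j}\<close> by (simp add: saddle_def Let_def)
  qed
  also have "?l CL = label_of_count (merged_count T g f (M i))"
    using stage_label_L[OF T iW] by (simp add: CL_def)
  also have "?l {R i, R j} = g {i, j}" using stage_label_R[OF T e] .
  also have "frob_mult (label_of_count (merged_count T g f (M i))) (g {i, j}) =
    (if merged_count ?T g f (M i) \<le> 1 then frag_of (label_of_count (merged_count ?T g f (M i))) else 0)"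
  proof -
    have "merged_count T g f (M i) \<le> 1" using le iW by blast
    then have "merged_count T g f (M i) = of_bool (label_of_count (merged_count T g f (M i)) = X)"
      by (auto simp: label_of_count_def)
    then have "merged_count ?T g f (M i) =
      of_bool (label_of_count (merged_count T g f (M i)) = X) + of_bool (g {i, j} = X)"
      using merged_count_insert[OF fin e(2), of g f "M i"] circle_of_self[of i "m \<union> b"] by simp
    then show ?thesis unfolding frob_mult_label by simp
  qed
  also have "frag_extend ?F \<dots> = stage_state g f ?T"
  proof (cases "merged_count ?T g f (M i) \<le> 1")
    case False
    then show ?thesis using iW by (auto simp: stage_state_def)
  next
    case True
    have other: "merged_count ?T g f C = merged_count T g f C" "C \<inter> points ?T = C \<inter> points T"
      if "C \<in> W" "C \<noteq> M i" for C
      using M_arc[OF e(1) that(1)] that merged_count_insert[OF fin e(2), of g f C] by auto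
    have all: "\<forall>C \<in> W. merged_count ?T g f C \<le> 1" using True other le by metis
    have "restrict (?l(C' := label_of_count (merged_count ?T g f (M i)))) (stage_circles k d b a ?T) 
        = stage_label g f ?T" (is "?lhs = _")
    proof
      fix Z
      show "?lhs Z = stage_label g f ?T Z"
      proof (cases "Z \<in> stage_circles k d b a ?T")
        case False
        then show ?thesis by (simp add: stage_label_def)
      next
        case True
        note mem = True
        show ?thesis
        proof (cases "Z = C'")
          case True
          then show ?thesis using mem stage_label_L[OF T' iW, of g f] by (simp add: C'_def)
        next
          case False
          from mem have "(\<exists>C \<in> W. Z = L ` C \<union> R ` (C \<inter> points ?T)) \<or>
            (\<exists>e \<in> b - ?T. Z = (\<lambda>(i, j). {R i, R j}) e)"
            unfolding stage_circles_eq[OF T'] Un_iff image_iff .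
          then consider C where "C \<in> W" "Z = L ` C \<union> R ` (C \<inter> points ?T)"
            | r s where "(r, s) \<in> b" "(r, s) \<notin> ?T" "Z = {R r, R s}"
            by fast
          then show ?thesis
          proof cases
            case 1
            then have "C \<noteq> M i" using False by (auto simp: C'_def)
            have "?lhs Z = ?l Z" using mem False by simp
            also have "\<dots> = stage_label g f ?T Z"
              using stage_label_L[OF T 1(1), of g f] stage_label_L[OF T' 1(1), of g f]
                other[OF 1(1) \<open>C \<noteq> M i\<close>] 1(2) by simp
            finally show ?thesis .
          next
            case 2
            have "?lhs Z = ?l Z" using mem False by simp
            also have "\<dots> = stage_label g f ?T Z"
              using stage_label_R[OF T, of r s g f] stage_label_R[OF T' 2(1,2), of g f] 2 by simp
            finally show ?thesis .
          qed
        qed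
      qed
    qed
    then show ?thesis using True all by (simp add: stage_state_def)
  qed
  finally show ?thesis .
qed

lemma saddle_stage_state:
  assumes T: "T \<subseteq> b" and e: "e \<in> b" "e \<notin> T"
  shows "frag_extend (saddle k d b a T e) (stage_state g f T) = stage_state g f (insert e T)"
proof (cases "\<forall>C \<in> W. merged_count T g f C \<le> 1")
  case True
  then show ?thesis
    using saddle_stage_label[OF T, of "fst e" "snd e" g f] e by (simp add: stage_state_def)
next
  case False
  have fin: "finite T" using T finite_subset finite_matching[OF b] by blast
  obtain C where C: "C \<in> W" "\<not> merged_count T g f C \<le> 1" using False by blast
  then have "\<not> merged_count (insert e T) g f C \<le> 1"
    using merged_count_insert[OF fin, of "fst e" "snd e" g f C] e by simp
  then show ?thesis using False C(1) by (auto simp: stage_state_def)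
qed

lemma saddles_stage_state:
  assumes "T \<union> set es \<subseteq> b" "T \<inter> set es = {}" "distinct es"
  shows "saddles k d b a T es (stage_state g f T) = stage_state g f (T \<union> set es)"
  using assms
proof (induction es arbitrary: T)
  case (Cons e es)
  then show ?case using saddle_stage_state[of T e g f] Cons.IH[of "insert e T"] by simp
qed simp

lemma stage_state_empty: "stage_state g f {} = frag_of (stage_label g f {})"
  by (auto simp: stage_state_def merged_count_def)

lemma stage_label_empty:
  "stage_label g f {} = disjoint_union_labelling k d b a (if L = Inl then g else f) (if L = Inl then f else g)"
proof
  fix Z
  show "stage_label g f {} Z = disjoint_union_labelling k d b a (if L = Inl then g else f) (if L = Inl then f else g) Z"
  proof (cases "Z \<in> stage_circles k d b a {}")
    case False
    then show ?thesis by (simp add: stage_label_def disjoint_union_labelling_def)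
  next
    case True
    then consider C where "C \<in> W" "Z = L ` C" | i j where "(i, j) \<in> b" "Z = {R i, R j}"
      by (auto simp: stage_circles_eq)
    then show ?thesis
    proof cases
      case 1
      obtain x where x: "x \<in> C" using W_nonempty 1 by blast
      have "stage_label g f {} Z = f C"
        using stage_label_L[of "{}" C g f] 1 
        by (cases "f C") (auto simp: merged_count_def label_of_count_def)
      moreover have "Inl -` (Inl ` C :: point2 set) = C" "Inr -` (Inr ` C :: point2 set) = C" by auto
      moreover have "\<not> (Inr ` C :: point2 set) \<subseteq> range Inl" using x by auto
      ultimately show ?thesis
        using sides 1 True by (auto simp: disjoint_union_labelling_def)
    next
      case 2
      have "stage_label g f {} Z = g {i, j}"
        using stage_label_R[of "{}" i j g f] 2 by simp
      moreover have "Inl -` {Inl i, Inl j :: point2} = {i, j}" "Inr -` {Inr i, Inr j :: point2} = {i, j}" by auto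
      ultimately show ?thesis
        using sides 2 True by (auto simp: disjoint_union_labelling_def)
    qed
  qed
qed

text \<open>Here g always labels W(b)b, whereas \<open>cobordism_map\<close> takes the label of
  W(d)b first; this accounts for the swap. After all saddles every R point is attached, so the
  circle over C is \<open>C <+> C\<close>.\<close>

lemma cobordism_map_merging:
  "cobordism_map k d b a (if L = Inl then g else f) (if L = Inl then f else g) =
    (if \<forall>C \<in> W. merged_count b g f C \<le> 1
     then frag_of (\<lambda>C \<in> W. label_of_count (merged_count b g f C)) else 0)"
proof -
  let ?es = "sorted_key_list_of_set fst b"
  have fin: "finite b" by (rule finite_matching[OF b]) simp
  have es: "set ?es = b" "distinct ?es"
    using sorted_key_list_of_set_inj_on[OF fin inj_on_fst_matching[OF b]] by auto
  have da: "W_circles k d a = W"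
    using sides by (auto simp: W_circles_def Un_commute)
  have "saddles k d b a {} ?es (stage_state g f {}) = stage_state g f b"
    using saddles_stage_state[of "{}" ?es g f] es by simp
  then have "cobordism_map k d b a (if L = Inl then g else f) (if L = Inl then f else g) =
    frag_extend (\<lambda>h. frag_of (\<lambda>C\<in>W. h (C <+> C))) (stage_state g f b)"
    unfolding cobordism_map_def stage_label_empty[symmetric] stage_state_empty[symmetric] da by simp
  moreover have "(\<lambda>C\<in>W. stage_label g f b (C <+> C)) = (\<lambda>C\<in>W. label_of_count (merged_count b g f C))"
  proof (rule restrict_ext)
    fix C assume C: "C \<in> W"
    have "C \<subseteq> {..<2 * k}"
      using W_circles_subset[OF m b, of C] C by (simp add: W_circles_def)
    then have "C \<inter> points b = C" using points_matching[OF b] by auto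
    then have "C <+> C = L ` C \<union> R ` (C \<inter> points b)" using sides by (auto simp: Plus_def)
    then show "stage_label g f b (C <+> C) = label_of_count (merged_count b g f C)"
      using stage_label_L[OF order_refl C, of g f] by simp
  qed
  ultimately show ?thesis by (simp add: stage_state_def)
qed

end

lemma cobordism_map_left:
  assumes "a \<in> crossingless_matchings k" "b \<in> crossingless_matchings k"
  shows "cobordism_map k b b a g f =
    (if \<forall>C \<in> W_circles k b a. merged_count b g f C \<le> 1
     then frag_of (\<lambda>C \<in> W_circles k b a. label_of_count (merged_count b g f C)) else 0)"
proof -
  interpret merging k b b a a Inl Inr
    by unfold_locales (use assms in \<open>auto simp: crossingless_matchings_iff\<close>)
  show ?thesis using cobordism_map_merging[of g f] by (simp add: W_circles_def)
qed

lemma cobordism_map_right: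
  assumes "d \<in> crossingless_matchings k" "b \<in> crossingless_matchings k"
  shows "cobordism_map k d b b g f =
    (if \<forall>C \<in> W_circles k d b. merged_count b f g C \<le> 1
     then frag_of (\<lambda>C \<in> W_circles k d b. label_of_count (merged_count b f g C)) else 0)"
proof -
  interpret merging k d b b d Inr Inl
    by unfold_locales (use assms in \<open>auto simp: crossingless_matchings_iff\<close>)
  have "(Inr :: nat \<Rightarrow> point2) \<noteq> Inl" by (metis Inr_not_Inl)
  then show ?thesis using cobordism_map_merging[of f g] by (simp add: W_circles_def Un_commute)
qed

section \<open>Central elements from monomials\<close>

lemma frag_extend_fun_diff:
  fixes f g :: "'a \<Rightarrow> 'b \<Rightarrow>\<^sub>0 int"
  shows "frag_extend (\<lambda>x. f x - g x) c = frag_extend f c - frag_extend g c"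
proof -
  have "frag_cmul n (x - y) = frag_cmul n x - frag_cmul n y" for n and x y :: "'b \<Rightarrow>\<^sub>0 int"
    by (rule poly_mapping_eqI) (simp add: lookup_minus right_diff_distrib)
  then show ?thesis by (simp add: frag_extend_def sum_subtractf)
qed

lemma lookup_frag_extend:
  assumes "finite A" "Poly_Mapping.keys c \<subseteq> A"
  shows "Poly_Mapping.lookup (frag_extend f c) x =
    (\<Sum>y\<in>A. Poly_Mapping.lookup c y * Poly_Mapping.lookup (f y) x)"
proof -
  have "Poly_Mapping.lookup (frag_extend f c) x =
    (\<Sum>y\<in>Poly_Mapping.keys c. Poly_Mapping.lookup c y * Poly_Mapping.lookup (f y) x)"
    by (simp add: frag_extend_def lookup_sum)
  also have "\<dots> = (\<Sum>y\<in>A. Poly_Mapping.lookup c y * Poly_Mapping.lookup (f y) x)"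
    using assms by (intro sum.mono_neutral_left) (auto simp: in_keys_iff)
  finally show ?thesis .
qed

lemma lookup_frag_extend_filter:
  "Poly_Mapping.lookup (frag_extend (\<lambda>q. if P q then frag_of q else 0) z) p =
    (if P p then Poly_Mapping.lookup z p else 0)"
proof -
  have eq: "Poly_Mapping.lookup z y * Poly_Mapping.lookup (if P y then frag_of y else 0) p =
    (if y = p then (if P p then Poly_Mapping.lookup z p else 0) else 0)" for y
    by auto
  have "Poly_Mapping.lookup (frag_extend (\<lambda>q. if P q then frag_of q else 0) z) p =
    (\<Sum>y\<in>insert p (Poly_Mapping.keys z). Poly_Mapping.lookup z y * Poly_Mapping.lookup (if P y then frag_of y else 0) p)"
    by (rule lookup_frag_extend) auto
  then show ?thesis unfolding eq by (subst (asm) sum.delta) auto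
qed

section \<open>The monomial basis of the diagonal summands\<close>

lemma inj_on_arc_points:
  assumes "matching_on V a"
  shows "inj_on (\<lambda>e. {fst e, snd e}) a"
proof (rule inj_onI)
  fix x y assume h: "x \<in> a" "y \<in> a" "{fst x, snd x} = {fst y, snd y}"
  obtain i j r s where xy: "x = (i, j)" "y = (r, s)" by (cases x, cases y)
  have "{i, j} = {r, s}" using h(3) xy by simp
  then have "i = r \<or> i = s" by (auto simp: doubleton_eq_iff)
  moreover have "(i, j) \<in> a" "(r, s) \<in> a" using h xy by simp_all
  ultimately show "x = y" using matching_on_share[OF assms, of i j r s] xy by blast
qed

lemma finite_crossingless_matchings: "finite (crossingless_matchings k)"
  by (rule finite_subset[of _ "Pow ({..<2 * k} \<times> {..<2 * k})"])
    (auto simp: crossingless_matchings_iff dest: matching_onD)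

lemma W_circles_same:
  assumes "a \<in> crossingless_matchings k"
  shows "W_circles k a a = (\<lambda>e. {fst e, snd e}) ` a"
proof -
  have m: "matching_on {..<2 * k} a" using assms by (simp add: crossingless_matchings_iff)
  have circ: "circle_of a x = {i, j}" if ij: "(i, j) \<in> a" "x = i \<or> x = j" for x i j
  proof (rule circle_of_eqI)
    show "r \<in> {i, j} \<longleftrightarrow> s \<in> {i, j}" if "(r, s) \<in> a" for r s
      using matching_on_share[OF m ij(1) that] by blast
    show "(x, y) \<in> (a \<union> a\<inverse>)\<^sup>*" if "y \<in> {i, j}" for y
      using that ij by auto
  qed (use ij in auto)
  show ?thesis
  proof (intro equalityI subsetI)
    fix C assume "C \<in> W_circles k a a"
    then obtain x where x: "x \<in> {..<2 * k}" "C = circle_of a x" by (auto simp: W_circles_def circles_def)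
    obtain i j where ij: "(i, j) \<in> a" "x = i \<or> x = j" using matching_on_cover[OF m x(1)] .
    then have "C = (\<lambda>e. {fst e, snd e}) (i, j)" using circ[OF ij] x by simp
    then show "C \<in> (\<lambda>e. {fst e, snd e}) ` a" using ij by blast
  next
    fix C assume "C \<in> (\<lambda>e. {fst e, snd e}) ` a"
    then obtain i j where ij: "(i, j) \<in> a" "C = {i, j}" by auto
    then have "C = circle_of a i" using circ[OF ij(1)] by simp
    then show "C \<in> W_circles k a a" using matching_onD[OF m ij(1)] by (auto simp: W_circles_def circles_def)
  qed
qed

text \<open>The monomial \<open>\<Prod>e\<in>S. X\<^sub>e\<close> in \<open>\<F>(W(a)a)\<close>, whose circles are the arcs of \<open>a\<close>.\<close>

definition arc_label :: "nat \<Rightarrow> matching \<Rightarrow> matching \<Rightarrow> nat set \<Rightarrow> frob" where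
  "arc_label k a S = (\<lambda>C \<in> W_circles k a a. if C \<in> (\<lambda>e. {fst e, snd e}) ` S then X else One)"

definition arc_monomial :: "nat \<Rightarrow> matching \<Rightarrow> matching \<Rightarrow> arc_gen" where
  "arc_monomial k a S = (a, a, arc_label k a S)"

lemma arc_label_arc:
  assumes "a \<in> crossingless_matchings k" "S \<subseteq> a" "e \<in> a"
  shows "arc_label k a S {fst e, snd e} = X \<longleftrightarrow> e \<in> S"
proof -
  have "inj_on (\<lambda>e. {fst e, snd e}) a"
    using assms by (intro inj_on_arc_points) (simp add: crossingless_matchings_iff)
  then have "{fst e, snd e} \<in> (\<lambda>e. {fst e, snd e}) ` S \<longleftrightarrow> e \<in> S"
    using assms(2,3) inj_on_image_mem_iff[of "\<lambda>e. {fst e, snd e}" a e S] by blast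
  moreover have "{fst e, snd e} \<in> W_circles k a a"
    using assms by (simp add: W_circles_same)
  ultimately show ?thesis by (simp add: arc_label_def)
qed

lemma arc_monomial_inject:
  assumes "a \<in> crossingless_matchings k" "S \<subseteq> a" "S' \<subseteq> a"
  shows "arc_monomial k a S = arc_monomial k a S' \<longleftrightarrow> S = S'"
proof
  assume "arc_monomial k a S = arc_monomial k a S'"
  then have eq: "arc_label k a S = arc_label k a S'"
    by (simp add: arc_monomial_def)
  have "e \<in> S \<longleftrightarrow> e \<in> S'" if "e \<in> a" for e
    using arc_label_arc[OF assms(1,2) that] arc_label_arc[OF assms(1,3) that]
    unfolding eq by (rule trans[OF sym])
  then show "S = S'" using assms by blast
qed simp

lemma arc_monomial_in_arc_gens:
  "a \<in> crossingless_matchings k \<Longrightarrow> arc_monomial k a S \<in> arc_gens k"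
  by (auto simp: arc_monomial_def arc_label_def arc_gens_def labellings_def)

text \<open>The circles of W(a)a are the arcs of a, so a labelling amounts to the set of arcs
  labelled X.\<close>

lemma diagonal_arc_gen:
  assumes "a \<in> crossingless_matchings k" "f \<in> labellings (W_circles k a a)"
  shows "(a, a, f) = arc_monomial k a {e \<in> a. f {fst e, snd e} = X}"
proof -
  have "f C = arc_label k a {e \<in> a. f {fst e, snd e} = X} C" (is "_ = ?g C") for C
  proof (cases "C \<in> W_circles k a a")
    case True
    then obtain e where e: "e \<in> a" "C = {fst e, snd e}" using W_circles_same[OF assms(1)] by auto
    have "?g C = X \<longleftrightarrow> f C = X"
      using arc_label_arc[OF assms(1), of "{e \<in> a. f {fst e, snd e} = X}" e] e by simp
    then show ?thesis by (cases "f C"; cases "?g C") auto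
  next
    case False
    then show ?thesis using assms(2) by (auto simp: labellings_def arc_label_def)
  qed
  then show ?thesis
    unfolding arc_monomial_def prod.inject by - (intro conjI refl ext)
qed

text \<open>W(a)a has one circle for each of the k arcs, of degree 1 for arcs in S and -1 otherwise;
  the shift by k turns the sum into twice the number of arcs in S.\<close>

lemma arc_deg_arc_monomial:
  assumes "a \<in> crossingless_matchings k" "S \<subseteq> a"
  shows "arc_deg k (arc_monomial k a S) = 2 * int (card S)"
proof -
  have m: "matching_on {..<2 * k} a" using assms by (simp add: crossingless_matchings_iff)
  have fin: "finite a" using finite_matching[OF m] by simp
  have "2 * card a = 2 * k" using card_points[OF m order_refl] points_matching[OF m] by simp
  let ?f = "arc_label k a S"
  have "(\<Sum>C \<in> W_circles k a a. frob_deg (?f C)) = (\<Sum>e \<in> a. frob_deg (?f {fst e, snd e}))"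
    unfolding W_circles_same[OF assms(1)] using inj_on_arc_points[OF m] by (subst sum.reindex) auto
  also have "\<dots> = (\<Sum>e \<in> a. 2 * of_bool (e \<in> S) - 1)"
  proof (rule sum.cong[OF refl])
    fix e assume "e \<in> a"
    show "frob_deg (?f {fst e, snd e}) = 2 * of_bool (e \<in> S) - 1"
      using arc_label_arc[OF assms \<open>e \<in> a\<close>] by (cases "?f {fst e, snd e}") auto
  qed
  also have "\<dots> = 2 * int (card S) - int (card a)"
    using fin assms(2) by (simp add: sum_subtractf sum_distrib_left[symmetric] sum_of_bool_eq Int_absorb1 of_bool_def sum.If_cases)
  finally show ?thesis using \<open>2 * card a = 2 * k\<close> by (simp add: arc_monomial_def)
qed

section \<open>Products with monomials\<close>

text \<open>A monomial on W(b)a given by exponents instead of labels and read modulo X^2 = 0 on each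
  circle. Products become sums of exponents, so the two orders of multiplication can be compared
  before reducing.\<close>

definition merged_gen :: "nat \<Rightarrow> matching \<Rightarrow> matching \<Rightarrow> (nat set \<Rightarrow> nat) \<Rightarrow> arc_gen \<Rightarrow>\<^sub>0 int" where
  "merged_gen k b a n =
    (if \<forall>C \<in> W_circles k b a. n C \<le> 1
     then frag_of (b, a, \<lambda>C \<in> W_circles k b a. label_of_count (n C)) else 0)"

lemma merged_gen_cong:
  assumes "\<And>C. C \<in> W_circles k b a \<Longrightarrow> n C = n' C"
  shows "merged_gen k b a n = merged_gen k b a n'"
proof -
  have "(\<lambda>C \<in> W_circles k b a. label_of_count (n C)) = (\<lambda>C \<in> W_circles k b a. label_of_count (n' C))"
    using assms by (intro restrict_ext) simp
  then show ?thesis using assms by (simp add: merged_gen_def)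
qed

lemma merged_count_arc_label:
  assumes "b \<in> crossingless_matchings k" "S \<subseteq> b"
  shows "merged_count b (arc_label k b S) f C = of_bool (f C = X) + card {e \<in> S. fst e \<in> C}"
proof -
  have "{e \<in> b. fst e \<in> C \<and> arc_label k b S {fst e, snd e} = X} = {e \<in> S. fst e \<in> C}"
    using arc_label_arc[OF assms] assms(2) by blast
  then show ?thesis by (simp add: merged_count_def)
qed

lemma arc_gen_mult_monomial_left:
  assumes "a \<in> crossingless_matchings k" "b \<in> crossingless_matchings k" "S \<subseteq> b"
  shows "arc_gen_mult k (arc_monomial k b S) (b, a, f) =
    merged_gen k b a (\<lambda>C. of_bool (f C = X) + card {e \<in> S. fst e \<in> C})"
proof -
  have "merged_count b (arc_label k b S) f C = of_bool (f C = X) + card {e \<in> S. fst e \<in> C}" for C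
    using merged_count_arc_label[OF assms(2,3)] .
  then show ?thesis
    unfolding arc_monomial_def using cobordism_map_left[OF assms(1,2)] by (simp add: merged_gen_def)
qed

lemma arc_gen_mult_monomial_right:
  assumes "a \<in> crossingless_matchings k" "b \<in> crossingless_matchings k" "S \<subseteq> a"
  shows "arc_gen_mult k (b, a, f) (arc_monomial k a S) =
    merged_gen k b a (\<lambda>C. of_bool (f C = X) + card {e \<in> S. fst e \<in> C})"
proof -
  have "merged_count a (arc_label k a S) f C = of_bool (f C = X) + card {e \<in> S. fst e \<in> C}" for C
    using merged_count_arc_label[OF assms(1,3)] .
  then show ?thesis
    unfolding arc_monomial_def using cobordism_map_right[OF assms(2,1)] by (simp add: merged_gen_def)
qed

lemma merged_gen_label:
  assumes "f \<in> labellings (W_circles k b a)"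
  shows "merged_gen k b a (\<lambda>C. of_bool (f C = X)) = frag_of (b, a, f)"
proof -
  have "label_of_count (of_bool (f C = X)) = f C" for C by (cases "f C") (auto simp: label_of_count_def)
  then have "(\<lambda>C \<in> W_circles k b a. label_of_count (of_bool (f C = X))) = f"
    using assms by (auto simp: labellings_def)
  then show ?thesis by (simp add: merged_gen_def)
qed

text \<open>The bound on n' matters because \<open>label_of_count\<close> does not separate
  exponents 1 and 2. If n exceeds 1 somewhere, the element is zero and n cannot agree with
  n'.\<close>

lemma lookup_merged_gen:
  assumes "\<And>C. C \<in> W_circles k b a \<Longrightarrow> n' C \<le> 1"
  shows "Poly_Mapping.lookup (merged_gen k b a n) (b, a, \<lambda>C \<in> W_circles k b a. label_of_count (n' C)) =
    of_bool (\<forall>C \<in> W_circles k b a. n C = n' C)"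
proof (cases "\<forall>C \<in> W_circles k b a. n C \<le> 1")
  case True
  have eq: "label_of_count (n C) = label_of_count (n' C) \<longleftrightarrow> n C = n' C" if "C \<in> W_circles k b a" for C
    using True assms[OF that] that by (force simp: label_of_count_def le_Suc_eq)
  have "(\<lambda>C \<in> W_circles k b a. label_of_count (n' C)) = (\<lambda>C \<in> W_circles k b a. label_of_count (n C))
    \<longleftrightarrow> (\<forall>C \<in> W_circles k b a. n C = n' C)" (is "?f' = ?f \<longleftrightarrow> _")
  proof
    assume "?f' = ?f"
    then show "\<forall>C \<in> W_circles k b a. n C = n' C" using eq by (metis restrict_apply')
  next
    assume "\<forall>C \<in> W_circles k b a. n C = n' C"
    then show "?f' = ?f" by (intro restrict_ext) simp
  qed
  then show ?thesis using True by (auto simp: merged_gen_def)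
next
  case False
  then obtain C where C: "C \<in> W_circles k b a" "\<not> n C \<le> 1" by blast
  then have "n C \<noteq> n' C" using assms[OF C(1)] by auto
  then have "\<not> (\<forall>C \<in> W_circles k b a. n C = n' C)" using C(1) by blast
  moreover have "merged_gen k b a n = 0" using False by (auto simp: merged_gen_def)
  ultimately show ?thesis by simp
qed

section \<open>The center and the images of the point monomials\<close>

abbreviation arc_prod :: "nat \<Rightarrow> (arc_gen \<Rightarrow>\<^sub>0 int) \<Rightarrow> (arc_gen \<Rightarrow>\<^sub>0 int) \<Rightarrow> (arc_gen \<Rightarrow>\<^sub>0 int)" where
  "arc_prod k u v \<equiv> frag_extend (\<lambda>p. frag_extend (arc_gen_mult k p) v) u"

text \<open>By bilinearity it is enough to commute with basis elements, and then each product is a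
  single linear extension.\<close>

lemma ring_center_arc_ring:
  "z \<in> ring_center (arc_ring k) \<longleftrightarrow> Poly_Mapping.keys z \<subseteq> arc_gens k \<and>
    (\<forall>q \<in> arc_gens k. frag_extend (\<lambda>p. arc_gen_mult k p q) z = frag_extend (arc_gen_mult k q) z)"
proof
  assume z: "z \<in> ring_center (arc_ring k)"
  have "frag_extend (\<lambda>p. arc_gen_mult k p q) z = frag_extend (arc_gen_mult k q) z" if "q \<in> arc_gens k" for q
  proof -
    have "\<forall>x. Poly_Mapping.keys x \<subseteq> arc_gens k \<longrightarrow> arc_prod k z x = arc_prod k x z"
      using z by (auto simp: ring_center_def arc_ring_def)
    then have "arc_prod k z (frag_of q) = arc_prod k (frag_of q) z"
      using that by (auto dest: spec[of _ "frag_of q"])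
    then show ?thesis by simp
  qed
  then show "Poly_Mapping.keys z \<subseteq> arc_gens k \<and>
    (\<forall>q \<in> arc_gens k. frag_extend (\<lambda>p. arc_gen_mult k p q) z = frag_extend (arc_gen_mult k q) z)"
    using z by (auto simp: ring_center_def arc_ring_def)
next
  assume z: "Poly_Mapping.keys z \<subseteq> arc_gens k \<and>
    (\<forall>q \<in> arc_gens k. frag_extend (\<lambda>p. arc_gen_mult k p q) z = frag_extend (arc_gen_mult k q) z)"
  have "arc_prod k z x = arc_prod k x z" if "Poly_Mapping.keys x \<subseteq> arc_gens k" for x
    using that
  proof (induction rule: frag_induction)
    case zero
    then show ?case by (simp add: frag_extend_eq_0)
  next
    case (one q)
    then show ?case using z by simp
  next
    case (diff x y)
    then show ?case by (simp add: frag_extend_diff frag_extend_fun_diff)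
  qed
  then show "z \<in> ring_center (arc_ring k)"
    using z by (auto simp: ring_center_def arc_ring_def)
qed

lemma ring_center_sum:
  assumes "finite Q" "\<And>T. T \<in> Q \<Longrightarrow> u T \<in> ring_center (arc_ring k)"
  shows "(\<Sum>T \<in> Q. frag_cmul (c T) (u T)) \<in> ring_center (arc_ring k)"
proof -
  have "Poly_Mapping.keys (\<Sum>T \<in> Q. frag_cmul (c T) (u T)) \<subseteq> (\<Union>T\<in>Q. Poly_Mapping.keys (frag_cmul (c T) (u T)))"
    by (rule keys_sum)
  also have "\<dots> \<subseteq> arc_gens k" using assms(2) by (auto simp: ring_center_arc_ring)
  finally show ?thesis
    using assms by (simp add: ring_center_arc_ring frag_extend_sum frag_extend_cmul)
qed

lemma ring_center_diff:
  assumes "u \<in> ring_center (arc_ring k)" "v \<in> ring_center (arc_ring k)"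
  shows "u - v \<in> ring_center (arc_ring k)"
  using assms keys_diff[of u v] by (auto simp: ring_center_arc_ring frag_extend_diff)

text \<open>
  The image of the monomial \<open>\<Prod>t\<in>T. X\<^sub>t\<close> of \<open>\<int>[X\<^sub>0, \<dots>, X\<^bsub>2k-1\<^esub>]/(X\<^sub>t\<^sup>2)\<close>; its component in
  \<open>\<F>(W(a)a)\<close> is obtained by setting \<open>X\<^sub>i = X\<^sub>j\<close> for each arc \<open>(i, j)\<close> of \<open>a\<close>.
\<close>

definition point_class :: "nat \<Rightarrow> nat set \<Rightarrow> arc_gen \<Rightarrow>\<^sub>0 int" where
  "point_class k T = (\<Sum>a \<in> crossingless_matchings k.
     if \<forall>e \<in> a. \<not> (fst e \<in> T \<and> snd e \<in> T)
     then frag_of (arc_monomial k a {e \<in> a. fst e \<in> T \<or> snd e \<in> T}) else 0)"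

text \<open>Each arc has at most one endpoint in T, and C contains both ends of an arc or neither.
  So choosing the endpoint in T is a bijection from the arcs counted here to
  \<open>T \<inter> C\<close>.\<close>

lemma card_arcs_meeting:
  assumes m: "matching_on V a" and C: "C \<subseteq> V" "\<And>i j. (i, j) \<in> a \<Longrightarrow> i \<in> C \<longleftrightarrow> j \<in> C"
    and T: "\<forall>e \<in> a. \<not> (fst e \<in> T \<and> snd e \<in> T)"
  shows "card {e \<in> a. (fst e \<in> T \<or> snd e \<in> T) \<and> fst e \<in> C} = card (T \<inter> C)"
proof (rule bij_betw_same_card[of "\<lambda>e. if fst e \<in> T then fst e else snd e"], rule bij_betw_imageI)
  let ?h = "\<lambda>e. if fst e \<in> T then fst e else snd e"
  let ?A = "{e \<in> a. (fst e \<in> T \<or> snd e \<in> T) \<and> fst e \<in> C}"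
  show "inj_on ?h ?A"
  proof (rule inj_onI)
    fix x y assume h: "x \<in> ?A" "y \<in> ?A" "?h x = ?h y"
    then have "(fst x, snd x) \<in> a" "(fst y, snd y) \<in> a" by simp_all
    note matching_on_share[OF m this]
    then show "x = y" using h(3) by (metis prod_eqI)
  qed
  show "?h ` ?A = T \<inter> C"
  proof (intro equalityI subsetI)
    fix t assume "t \<in> ?h ` ?A"
    then obtain e where e: "e \<in> ?A" "t = ?h e" by blast
    then obtain i j where ij: "(i, j) \<in> ?A" "t = ?h (i, j)" by (cases e) blast
    then show "t \<in> T \<inter> C" using C(2)[of i j] by (auto split: if_splits)
  next
    fix t assume t: "t \<in> T \<inter> C"
    then have "t \<in> V" using C by auto
    then obtain i j where ij: "(i, j) \<in> a" "t = i \<or> t = j" using matching_on_cover[OF m] by metis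
    then have "t = ?h (i, j)" "(i, j) \<in> ?A" using t T C(2)[OF ij(1)] by auto
    then show "t \<in> ?h ` ?A" by blast
  qed
qed

text \<open>The right-hand side does not mention d: X puts the exponent
  \<open>card (T \<inter> C)\<close> on C whether X_T acts through a or through b. If an arc of d
  has both ends in T, the component at d is zero, and so is the right-hand side, since the circle
  through this arc has exponent at least 2.\<close>

lemma point_class_component_mult:
  assumes a: "a \<in> crossingless_matchings k" and b: "b \<in> crossingless_matchings k"
    and d: "d = a \<or> d = b"
  shows "(if \<forall>e \<in> d. \<not> (fst e \<in> T \<and> snd e \<in> T)
      then merged_gen k b a (\<lambda>C. of_bool (f C = X) + card {e \<in> {e \<in> d. fst e \<in> T \<or> snd e \<in> T}. fst e \<in> C}) else 0) =
    merged_gen k b a (\<lambda>C. of_bool (f C = X) + card (T \<inter> C))"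
proof -
  have ma: "matching_on {..<2 * k} a" and mb: "matching_on {..<2 * k} b" and md: "matching_on {..<2 * k} d"
    using a b d by (auto simp: crossingless_matchings_iff)
  have C: "C \<subseteq> {..<2 * k}" if "C \<in> W_circles k b a" for C
    using W_circles_subset[OF ma mb that] .
  have arc: "i \<in> C \<longleftrightarrow> j \<in> C" if "C \<in> W_circles k b a" "(i, j) \<in> d" for C i j
  proof -
    have "(i, j) \<in> a \<union> b" using that d by auto
    then show ?thesis using that(1) circle_of_edge[of i j "a \<union> b"] by (auto simp: W_circles_def circles_def)
  qed
  show ?thesis
  proof (cases "\<forall>e \<in> d. \<not> (fst e \<in> T \<and> snd e \<in> T)")
    case True
    have eq: "card {e \<in> {e \<in> d. fst e \<in> T \<or> snd e \<in> T}. fst e \<in> C} = card (T \<inter> C)"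
      if "C \<in> W_circles k b a" for C
    proof -
      have "{e \<in> {e \<in> d. fst e \<in> T \<or> snd e \<in> T}. fst e \<in> C} = {e \<in> d. (fst e \<in> T \<or> snd e \<in> T) \<and> fst e \<in> C}"
        by auto
      then show ?thesis using card_arcs_meeting[OF md C[OF that] arc[OF that] True] by simp
    qed
    show ?thesis
      unfolding if_P[OF True] by (rule merged_gen_cong) (simp only: eq)
  next
    case False
    then obtain i j where ij: "(i, j) \<in> d" "i \<in> T" "j \<in> T" by auto
    define C where "C = circle_of (a \<union> b) i"
    have CW: "C \<in> W_circles k b a"
      using matching_onD(2)[OF md ij(1)] by (auto simp: C_def W_circles_def circles_def)
    have "i \<in> C" "j \<in> C" using circle_of_self[of i] arc[OF CW ij(1)] by (auto simp: C_def)
    then have "{i, j} \<subseteq> T \<inter> C" using ij by auto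
    then have "card {i, j} \<le> card (T \<inter> C)" using finite_subset[OF C[OF CW]] by (intro card_mono) auto
    then have "\<not> of_bool (f C = X) + card (T \<inter> C) \<le> 1" using matching_onD(1)[OF md ij(1)] by auto
    then have "merged_gen k b a (\<lambda>C. of_bool (f C = X) + card (T \<inter> C)) = 0"
      using CW unfolding merged_gen_def by (intro if_not_P) blast
    then show ?thesis unfolding if_not_P[OF False] by (rule sym)
  qed
qed

text \<open>Only the component at b acts on F(W(b)a) from the left and only the component at a from
  the right; both give the same element by the preceding lemma.\<close>

lemma point_class_central: "point_class k T \<in> ring_center (arc_ring k)"
proof -
  let ?B = "crossingless_matchings k"
  let ?u = "\<lambda>a. if \<forall>e \<in> a. \<not> (fst e \<in> T \<and> snd e \<in> T)
     then frag_of (arc_monomial k a {e \<in> a. fst e \<in> T \<or> snd e \<in> T}) else 0"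
  note fin = finite_crossingless_matchings[of k]
  have "Poly_Mapping.keys (point_class k T) \<subseteq> (\<Union>a \<in> ?B. Poly_Mapping.keys (?u a))"
    unfolding point_class_def by (rule keys_sum)
  also have "\<dots> \<subseteq> arc_gens k"
    using arc_monomial_in_arc_gens by (intro UN_least) simp
  finally have keys: "Poly_Mapping.keys (point_class k T) \<subseteq> arc_gens k" .
  have "frag_extend (\<lambda>p. arc_gen_mult k p q) (point_class k T) = frag_extend (arc_gen_mult k q) (point_class k T)"
    if q: "q \<in> arc_gens k" for q
  proof -
    obtain b a f where baf: "q = (b, a, f)" "b \<in> ?B" "a \<in> ?B" using q by (auto simp: arc_gens_def)
    let ?m = "merged_gen k b a (\<lambda>C. of_bool (f C = X) + card (T \<inter> C))"
    have "frag_extend (\<lambda>p. arc_gen_mult k p q) (?u c) = (if c = b then ?m else 0)" if "c \<in> ?B" for c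
    proof (cases "c = b")
      case True
      show ?thesis
        using point_class_component_mult[OF baf(3,2), of b T f]
          arc_gen_mult_monomial_left[OF baf(3,2), of "{e \<in> b. fst e \<in> T \<or> snd e \<in> T}" f]
        by (auto simp: True baf(1) split: if_splits)
    next
      case False
      then show ?thesis by (simp add: baf(1) arc_monomial_def)
    qed
    moreover have "frag_extend (arc_gen_mult k q) (?u c) = (if c = a then ?m else 0)" if "c \<in> ?B" for c
    proof (cases "c = a")
      case True
      show ?thesis
        using point_class_component_mult[OF baf(3,2), of a T f]
          arc_gen_mult_monomial_right[OF baf(3,2), of "{e \<in> a. fst e \<in> T \<or> snd e \<in> T}" f]
        by (auto simp: True baf(1) split: if_splits)
    next
      case False
      then show ?thesis by (simp add: baf(1) arc_monomial_def)
    qed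
    ultimately show ?thesis
      using fin baf(2,3) unfolding point_class_def frag_extend_sum[OF fin] by (simp add: sum.delta)
  qed
  then show ?thesis using keys by (simp add: ring_center_arc_ring)
qed

lemma lookup_point_class:
  assumes "a \<in> crossingless_matchings k" "S \<subseteq> a"
  shows "Poly_Mapping.lookup (point_class k T) (arc_monomial k a S) =
    of_bool ((\<forall>e \<in> a. \<not> (fst e \<in> T \<and> snd e \<in> T)) \<and> {e \<in> a. fst e \<in> T \<or> snd e \<in> T} = S)"
proof -
  let ?u = "\<lambda>a. if \<forall>e \<in> a. \<not> (fst e \<in> T \<and> snd e \<in> T)
     then frag_of (arc_monomial k a {e \<in> a. fst e \<in> T \<or> snd e \<in> T}) else 0"
  let ?r = "of_bool ((\<forall>e \<in> a. \<not> (fst e \<in> T \<and> snd e \<in> T)) \<and> {e \<in> a. fst e \<in> T \<or> snd e \<in> T} = S) :: int"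
  have "Poly_Mapping.lookup (?u c) (arc_monomial k a S) = (if c = a then ?r else 0)" 
    if "c \<in> crossingless_matchings k" for c
  proof (cases "c = a")
    case True
    then show ?thesis
      using arc_monomial_inject[OF assms, of "{e \<in> a. fst e \<in> T \<or> snd e \<in> T}"] by auto
  next
    case False
    then show ?thesis by (auto simp: arc_monomial_def)
  qed
  then show ?thesis
    using assms finite_crossingless_matchings[of k] by (simp add: point_class_def lookup_sum sum.delta)
qed

section \<open>Relations satisfied by a central element\<close>

lemma in_arc_gensD:
  assumes "(b, a, f) \<in> arc_gens k"
  shows "b \<in> crossingless_matchings k" "a \<in> crossingless_matchings k" "f \<in> labellings (W_circles k b a)"
  using assms by (auto simp: arc_gens_def)

lemma central_diagonal:
  assumes z: "z \<in> ring_center (arc_ring k)" and p: "(b, a, f) \<in> Poly_Mapping.keys z"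
  shows "b = a"
proof -
  have keys: "Poly_Mapping.keys z \<subseteq> arc_gens k" using z by (simp add: ring_center_arc_ring)
  then have "(b, a, f) \<in> arc_gens k" using p by blast
  note baf = in_arc_gensD[OF this]
  \<comment> \<open>The idempotent at b, with all circles of W(b)b labelled One: as a left factor it
    keeps the terms with first index b, as a right factor those with second index b.\<close>
  let ?q = "arc_monomial k b {}"
  have "frag_extend (arc_gen_mult k ?q) z = frag_extend (\<lambda>p. if fst p = b then frag_of p else 0) z"
  proof (rule frag_extend_eq)
    fix p assume "p \<in> Poly_Mapping.keys z"
    then have "p \<in> arc_gens k" using keys by blast
    then obtain b' a' f' where p: "p = (b', a', f')" "(b', a', f') \<in> arc_gens k" by (cases p) auto
    note p' = in_arc_gensD[OF p(2)]
    show "arc_gen_mult k ?q p = (if fst p = b then frag_of p else 0)"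
    proof (cases "b' = b")
      case True
      then show ?thesis
        using arc_gen_mult_monomial_left[OF p'(2,1), of "{}" f'] merged_gen_label[OF p'(3)] p by simp
    next
      case False
      then show ?thesis by (simp add: p arc_monomial_def)
    qed
  qed
  moreover have "frag_extend (\<lambda>p. arc_gen_mult k p ?q) z = frag_extend (\<lambda>p. if fst (snd p) = b then frag_of p else 0) z"
  proof (rule frag_extend_eq)
    fix p assume "p \<in> Poly_Mapping.keys z"
    then have "p \<in> arc_gens k" using keys by blast
    then obtain b' a' f' where p: "p = (b', a', f')" "(b', a', f') \<in> arc_gens k" by (cases p) auto
    note p' = in_arc_gensD[OF p(2)]
    show "arc_gen_mult k p ?q = (if fst (snd p) = b then frag_of p else 0)"
    proof (cases "a' = b")
      case True
      then show ?thesis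
        using arc_gen_mult_monomial_right[OF p'(2,1), of "{}" f'] merged_gen_label[OF p'(3)] p by simp
    next
      case False
      then show ?thesis by (simp add: p arc_monomial_def)
    qed
  qed
  moreover have "frag_extend (\<lambda>p. arc_gen_mult k p ?q) z = frag_extend (arc_gen_mult k ?q) z"
    using z arc_monomial_in_arc_gens[OF baf(1)] by (simp add: ring_center_arc_ring)
  ultimately have "Poly_Mapping.lookup (frag_extend (\<lambda>p. if fst p = b then frag_of p else 0) z) (b, a, f) =
    Poly_Mapping.lookup (frag_extend (\<lambda>p. if fst (snd p) = b then frag_of p else 0) z) (b, a, f)"
    by simp
  then show ?thesis
    using p unfolding lookup_frag_extend_filter by (auto simp: in_keys_iff split: if_splits)
qed

lemma central_keys:
  assumes "z \<in> ring_center (arc_ring k)" "p \<in> Poly_Mapping.keys z"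
  obtains a S where "a \<in> crossingless_matchings k" "S \<subseteq> a" "p = arc_monomial k a S"
proof -
  obtain b a f where p: "p = (b, a, f)" by (cases p)
  have "p \<in> arc_gens k" using assms by (auto simp: ring_center_arc_ring)
  then have "b = a" and a: "a \<in> crossingless_matchings k" "f \<in> labellings (W_circles k b a)"
    using assms p in_arc_gensD[of b a f k] central_diagonal[of z k b a f] by auto
  then have "p = arc_monomial k a {e \<in> a. f {fst e, snd e} = X}"
    using diagonal_arc_gen[of a k f] p by simp
  then show ?thesis using a(1) by (intro that[of a "{e \<in> a. f {fst e, snd e} = X}"]) auto
qed

lemma lookup_frag_extend_central:
  assumes z: "z \<in> ring_center (arc_ring k)" and a: "a \<in> crossingless_matchings k"
    and F: "\<And>b S. b \<in> crossingless_matchings k \<Longrightarrow> b \<noteq> a \<Longrightarrow> F (arc_monomial k b S) = 0"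
  shows "Poly_Mapping.lookup (frag_extend F z) x =
    (\<Sum>S\<in>Pow a. Poly_Mapping.lookup z (arc_monomial k a S) * Poly_Mapping.lookup (F (arc_monomial k a S)) x)"
proof -
  let ?G = "\<lambda>p. Poly_Mapping.lookup z p * Poly_Mapping.lookup (F p) x"
  have fin: "finite (Pow a)"
    using a finite_matching[of "{..<2 * k}" a] by (simp add: crossingless_matchings_iff)
  let ?A = "arc_monomial k a ` Pow a"
  have "Poly_Mapping.lookup (frag_extend F z) x = (\<Sum>p\<in>Poly_Mapping.keys z \<union> ?A. ?G p)"
    using fin by (intro lookup_frag_extend) auto
  also have "\<dots> = (\<Sum>p\<in>?A. ?G p)"
  proof (rule sum.mono_neutral_right)
    show "\<forall>p\<in>Poly_Mapping.keys z \<union> ?A - ?A. ?G p = 0"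
    proof
      fix p assume p: "p \<in> Poly_Mapping.keys z \<union> ?A - ?A"
      then obtain b S where bS: "b \<in> crossingless_matchings k" "S \<subseteq> b" "p = arc_monomial k b S"
        using central_keys[OF z, of p] by blast
      then have "b \<noteq> a" using p by blast
      then show "?G p = 0" using F[OF bS(1)] bS(3) by simp
    qed
  qed (use fin in auto)
  also have "\<dots> = (\<Sum>S\<in>Pow a. ?G (arc_monomial k a S))"
  proof (rule sum.reindex_cong[OF _ refl refl])
    show "inj_on (arc_monomial k a) (Pow a)"
      using arc_monomial_inject[OF a] by (intro inj_onI) auto
  qed
  finally show ?thesis .
qed

text \<open>Both sides are the coefficient of the monomial with exponents n in the two products of z
  with the element of F(W(a)c) all of whose labels are One. There an arc set S contributes to each
  circle the number of its arcs on that circle.\<close>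

lemma central_restrictions_agree:
  assumes z: "z \<in> ring_center (arc_ring k)"
    and a: "a \<in> crossingless_matchings k" and c: "c \<in> crossingless_matchings k"
    and n: "\<And>C. C \<in> W_circles k a c \<Longrightarrow> n C \<le> 1"
  shows "(\<Sum>S\<in>Pow a. Poly_Mapping.lookup z (arc_monomial k a S) *
      of_bool (\<forall>C \<in> W_circles k a c. card {e \<in> S. fst e \<in> C} = n C)) =
    (\<Sum>S\<in>Pow c. Poly_Mapping.lookup z (arc_monomial k c S) *
      of_bool (\<forall>C \<in> W_circles k a c. card {e \<in> S. fst e \<in> C} = n C))"
proof -
  define f where "f = (\<lambda>C \<in> W_circles k a c. One)"
  let ?q = "(a, c, f)"
  let ?x = "(a, c, \<lambda>C \<in> W_circles k a c. label_of_count (n C))"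
  have q: "?q \<in> arc_gens k" using a c by (auto simp: f_def arc_gens_def labellings_def)
  have m: "merged_gen k a c (\<lambda>C. of_bool (f C = X) + card {e \<in> S. fst e \<in> C}) =
    merged_gen k a c (\<lambda>C. card {e \<in> S. fst e \<in> C})" for S
    by (rule merged_gen_cong) (simp add: f_def)
  have "Poly_Mapping.lookup (frag_extend (\<lambda>p. arc_gen_mult k p ?q) z) ?x =
    (\<Sum>S\<in>Pow a. Poly_Mapping.lookup z (arc_monomial k a S) *
      Poly_Mapping.lookup (arc_gen_mult k (arc_monomial k a S) ?q) ?x)"
    by (rule lookup_frag_extend_central[OF z a]) (simp add: arc_monomial_def)
  also have "\<dots> = (\<Sum>S\<in>Pow a. Poly_Mapping.lookup z (arc_monomial k a S) *
      of_bool (\<forall>C \<in> W_circles k a c. card {e \<in> S. fst e \<in> C} = n C))"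
  proof (rule sum.cong[OF refl])
    fix S assume "S \<in> Pow a"
    then have "arc_gen_mult k (arc_monomial k a S) ?q = merged_gen k a c (\<lambda>C. card {e \<in> S. fst e \<in> C})"
      using arc_gen_mult_monomial_left[OF c a, of S f] m by simp
    then show "Poly_Mapping.lookup z (arc_monomial k a S) *
        Poly_Mapping.lookup (arc_gen_mult k (arc_monomial k a S) ?q) ?x =
      Poly_Mapping.lookup z (arc_monomial k a S) *
        of_bool (\<forall>C \<in> W_circles k a c. card {e \<in> S. fst e \<in> C} = n C)"
      using lookup_merged_gen[OF n] by simp
  qed
  finally have left: "Poly_Mapping.lookup (frag_extend (\<lambda>p. arc_gen_mult k p ?q) z) ?x =
    (\<Sum>S\<in>Pow a. Poly_Mapping.lookup z (arc_monomial k a S) *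
      of_bool (\<forall>C \<in> W_circles k a c. card {e \<in> S. fst e \<in> C} = n C))" .
  have "Poly_Mapping.lookup (frag_extend (arc_gen_mult k ?q) z) ?x =
    (\<Sum>S\<in>Pow c. Poly_Mapping.lookup z (arc_monomial k c S) *
      Poly_Mapping.lookup (arc_gen_mult k ?q (arc_monomial k c S)) ?x)"
    by (rule lookup_frag_extend_central[OF z c]) (simp add: arc_monomial_def)
  also have "\<dots> = (\<Sum>S\<in>Pow c. Poly_Mapping.lookup z (arc_monomial k c S) *
      of_bool (\<forall>C \<in> W_circles k a c. card {e \<in> S. fst e \<in> C} = n C))"
  proof (rule sum.cong[OF refl])
    fix S assume "S \<in> Pow c"
    then have "arc_gen_mult k ?q (arc_monomial k c S) = merged_gen k a c (\<lambda>C. card {e \<in> S. fst e \<in> C})"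
      using arc_gen_mult_monomial_right[OF c a, of S f] m by simp
    then show "Poly_Mapping.lookup z (arc_monomial k c S) *
        Poly_Mapping.lookup (arc_gen_mult k ?q (arc_monomial k c S)) ?x =
      Poly_Mapping.lookup z (arc_monomial k c S) *
        of_bool (\<forall>C \<in> W_circles k a c. card {e \<in> S. fst e \<in> C} = n C)"
      using lookup_merged_gen[OF n] by simp
  qed
  finally have right: "Poly_Mapping.lookup (frag_extend (arc_gen_mult k ?q) z) ?x =
    (\<Sum>S\<in>Pow c. Poly_Mapping.lookup z (arc_monomial k c S) *
      of_bool (\<forall>C \<in> W_circles k a c. card {e \<in> S. fst e \<in> C} = n C))" .
  have "frag_extend (\<lambda>p. arc_gen_mult k p ?q) z = frag_extend (arc_gen_mult k ?q) z"
    using z q by (simp add: ring_center_arc_ring)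
  then show ?thesis using left right by simp
qed

section \<open>Comparing matchings that differ by one unnesting\<close>

text \<open>Following arcs of a and c alternately gives the closed path i, j, q, p; every other arc
  is common to a and c and closes up to a circle of two points.\<close>

lemma W_circles_unnest:
  assumes a: "matching_on {..<2 * k} a" and c: "matching_on {..<2 * k} c"
    and eqs: "a = insert (i, j) (insert (p, q) a0)" "c = insert (p, i) (insert (j, q) a0)"
    and new: "(i, j) \<notin> a0" "(p, q) \<notin> a0"
  shows "W_circles k a c = (\<lambda>e. {fst e, snd e}) ` a0 \<union> {{i, j, p, q}}"
proof -
  let ?Q = "{i, j, p, q}"
  let ?E = "c \<union> a"
  note sh = matching_on_share[OF a]
  have E: "?E = {(i, j), (p, q), (p, i), (j, q)} \<union> a0" using eqs by auto
  have sep: "{r, s} \<inter> ?Q = {}" if "(r, s) \<in> a0" for r s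
  proof -
    have "(r, s) \<noteq> (i, j)" "(r, s) \<noteq> (p, q)" "(r, s) \<in> a" "(i, j) \<in> a" "(p, q) \<in> a" using that new eqs by auto
    then show ?thesis using sh[of r s i j] sh[of r s p q] by blast
  qed
  have arc: "circle_of ?E x = {r, s}" if rs: "(r, s) \<in> a0" "x = r \<or> x = s" for r s x
  proof (rule circle_of_eqI)
    show "x \<in> {r, s}" using rs by auto
    show "u \<in> {r, s} \<longleftrightarrow> v \<in> {r, s}" if "(u, v) \<in> ?E" for u v
    proof (cases "(u, v) \<in> a0")
      case True
      then have "(u, v) \<in> a" "(r, s) \<in> a" using eqs rs by auto
      then show ?thesis using sh[of u v r s] by blast
    next
      case False
      then have "u \<in> ?Q" "v \<in> ?Q" using that E by auto
      then show ?thesis using sep[OF rs(1)] by blast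
    qed
    show "(x, y) \<in> (?E \<union> ?E\<inverse>)\<^sup>*" if "y \<in> {r, s}" for y
      using that rs E by auto
  qed
  have Qi: "circle_of ?E i = ?Q"
  proof (rule circle_of_eqI)
    show "u \<in> ?Q \<longleftrightarrow> v \<in> ?Q" if "(u, v) \<in> ?E" for u v
    proof (cases "(u, v) \<in> a0")
      case True
      then show ?thesis using sep[OF True] by blast
    next
      case False
      then show ?thesis using that E by auto
    qed
    have st: "(i, j) \<in> ?E \<union> ?E\<inverse>" "(j, q) \<in> ?E \<union> ?E\<inverse>" "(i, p) \<in> ?E \<union> ?E\<inverse>" using eqs by auto
    show "(i, y) \<in> (?E \<union> ?E\<inverse>)\<^sup>*" if "y \<in> ?Q" for y
      using that st by (auto intro: r_into_rtrancl converse_rtrancl_into_rtrancl)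
  qed simp
  have Q: "circle_of ?E x = ?Q" if "x \<in> ?Q" for x
    using circle_of_eq[of x ?E i] that Qi by simp
  show ?thesis
  proof (intro equalityI subsetI)
    fix C assume "C \<in> W_circles k a c"
    then obtain x where x: "x \<in> {..<2 * k}" "C = circle_of ?E x" by (auto simp: W_circles_def circles_def)
    obtain r s where rs: "(r, s) \<in> a" "x = r \<or> x = s" using matching_on_cover[OF a x(1)] .
    show "C \<in> (\<lambda>e. {fst e, snd e}) ` a0 \<union> {?Q}"
    proof (cases "(r, s) \<in> a0")
      case True
      then have "C = (\<lambda>e. {fst e, snd e}) (r, s)" using arc[OF True rs(2)] x by simp
      then show ?thesis using True by blast
    next
      case False
      then have "x \<in> ?Q" using rs eqs by auto
      then show ?thesis using Q x by simp
    qed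
  next
    fix C assume "C \<in> (\<lambda>e. {fst e, snd e}) ` a0 \<union> {?Q}"
    then consider r s where "(r, s) \<in> a0" "C = {r, s}" | "C = ?Q" by auto
    then have "\<exists>x \<in> {..<2 * k}. C = circle_of ?E x"
    proof cases
      case 1
      then have "(r, s) \<in> a" using eqs by auto
      then have "r \<in> {..<2 * k}" by (rule matching_onD(2)[OF a])
      moreover have "C = circle_of ?E r" using arc[OF 1(1)] 1(2) by simp
      ultimately show ?thesis by blast
    next
      case 2
      have "(i, j) \<in> a" using eqs by auto
      then have "i \<in> {..<2 * k}" by (rule matching_onD(2)[OF a])
      then show ?thesis using Qi 2 by blast
    qed
    then show "C \<in> W_circles k a c" by (auto simp: W_circles_def circles_def)
  qed
qed

lemma matching_arc_eqI:
  assumes "matching_on V a" "x \<in> a" "y \<in> a" "fst y \<in> {fst x, snd x}"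
  shows "y = x"
proof -
  obtain r s u v where xy: "x = (r, s)" "y = (u, v)" by (cases x, cases y)
  then have "(u, v) \<in> a" "(r, s) \<in> a" "u = r \<or> u = s" using assms(2-4) by simp_all
  then show ?thesis using matching_on_share[OF assms(1), of u v r s] xy by blast
qed

text \<open>Q stands for the four-point circle, d and e for the two arcs of a matching on it, and t
  tells whether Q carries X. The counts fix S' on the shared arcs; on Q they demand exactly one of d
  and e if t holds, and neither otherwise. The two choices are the source of the sums of two
  coefficients.\<close>

lemma arc_sets_with_counts:
  assumes a: "matching_on V a" and eq: "a = insert d (insert e a0)"
    and new: "d \<notin> a0" "e \<notin> a0" "d \<noteq> e" and Q: "fst d \<in> Q" "fst e \<in> Q" "\<And>x. x \<in> a0 \<Longrightarrow> fst x \<notin> Q"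
    and S: "S \<subseteq> a0"
  shows "{S' \<in> Pow a. \<forall>C \<in> (\<lambda>e. {fst e, snd e}) ` a0 \<union> {Q}.
      card {x \<in> S'. fst x \<in> C} = card {x \<in> S. fst x \<in> C} + of_bool (t \<and> C = Q)} =
    (if t then {insert d S, insert e S} else {S})"
proof -
  have arc: "card {y \<in> S'. fst y \<in> {fst x, snd x}} = of_bool (x \<in> S')" if "S' \<subseteq> a" "x \<in> a0" for S' x
  proof -
    have "y = x" if "y \<in> S'" "fst y \<in> {fst x, snd x}" for y
      by (rule matching_arc_eqI[OF a]) (use \<open>S' \<subseteq> a\<close> \<open>x \<in> a0\<close> that eq in auto)
    note uniq = this
    show ?thesis
    proof (cases "x \<in> S'")
      case True
      then have "{y \<in> S'. fst y \<in> {fst x, snd x}} = {x}" using uniq by blast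
      then show ?thesis using True by (simp only: card.insert) simp
    next
      case False
      then have "{y \<in> S'. fst y \<in> {fst x, snd x}} = {}" using uniq by blast
      then show ?thesis using False by (simp only: card.empty) simp
    qed
  qed
  have "{x \<in> S'. fst x \<in> Q} = S' \<inter> {d, e}" if "S' \<subseteq> a" for S'
    using that Q eq by blast
  then have cQ: "card {x \<in> S'. fst x \<in> Q} = of_bool (d \<in> S') + of_bool (e \<in> S')" if "S' \<subseteq> a" for S'
    using that new(3) by (auto simp: Int_insert_right)
  have Sa: "S \<subseteq> a" using S eq by auto
  have dS: "d \<notin> S" "e \<notin> S" using S new by auto
  have ne: "{fst x, snd x} \<noteq> Q" if "x \<in> a0" for x using Q(3)[OF that] by blast
  have "(\<forall>C \<in> (\<lambda>e. {fst e, snd e}) ` a0 \<union> {Q}.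
      card {x \<in> S'. fst x \<in> C} = card {x \<in> S. fst x \<in> C} + of_bool (t \<and> C = Q)) \<longleftrightarrow>
    (\<forall>x \<in> a0. x \<in> S' \<longleftrightarrow> x \<in> S) \<and> (of_bool (d \<in> S') + of_bool (e \<in> S') = (of_bool t :: nat))" 
    if "S' \<subseteq> a" for S'
  proof -
    let ?P = "\<lambda>C. card {x \<in> S'. fst x \<in> C} = card {x \<in> S. fst x \<in> C} + of_bool (t \<and> C = Q)"
    have "?P {fst x, snd x} \<longleftrightarrow> (x \<in> S' \<longleftrightarrow> x \<in> S)" if "x \<in> a0" for x
      unfolding arc[OF \<open>S' \<subseteq> a\<close> that] arc[OF Sa that] using ne[OF that] by simp
    moreover have "?P Q \<longleftrightarrow> of_bool (d \<in> S') + of_bool (e \<in> S') = (of_bool t :: nat)"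
      unfolding cQ[OF that] cQ[OF Sa] using dS by simp
    moreover have "(\<forall>C \<in> (\<lambda>e. {fst e, snd e}) ` a0 \<union> {Q}. ?P C) \<longleftrightarrow> (\<forall>x \<in> a0. ?P {fst x, snd x}) \<and> ?P Q"
      by blast
    ultimately show ?thesis by simp
  qed
  then have "{S' \<in> Pow a. \<forall>C \<in> (\<lambda>e. {fst e, snd e}) ` a0 \<union> {Q}.
      card {x \<in> S'. fst x \<in> C} = card {x \<in> S. fst x \<in> C} + of_bool (t \<and> C = Q)} =
    {S' \<in> Pow a. (\<forall>x \<in> a0. x \<in> S' \<longleftrightarrow> x \<in> S) \<and> (of_bool (d \<in> S') + of_bool (e \<in> S') = (of_bool t :: nat))}"
    by blast
  also have "\<dots> = (if t then {insert d S, insert e S} else {S})"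
  proof (cases t)
    case True
    have "(S' \<subseteq> a \<and> (\<forall>x \<in> a0. x \<in> S' \<longleftrightarrow> x \<in> S) \<and> (d \<in> S') \<noteq> (e \<in> S')) \<longleftrightarrow> S' = insert d S \<or> S' = insert e S" for S'
    proof
      assume h: "S' \<subseteq> a \<and> (\<forall>x \<in> a0. x \<in> S' \<longleftrightarrow> x \<in> S) \<and> (d \<in> S') \<noteq> (e \<in> S')"
      have "x \<in> S' \<longleftrightarrow> x = d \<and> d \<in> S' \<or> x = e \<and> e \<in> S' \<or> x \<in> S" for x
        using h S eq by blast
      then show "S' = insert d S \<or> S' = insert e S" using h by blast
    next
      assume "S' = insert d S \<or> S' = insert e S"
      then show "S' \<subseteq> a \<and> (\<forall>x \<in> a0. x \<in> S' \<longleftrightarrow> x \<in> S) \<and> (d \<in> S') \<noteq> (e \<in> S')"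
        using Sa dS new eq by auto
    qed
    moreover have "of_bool P + of_bool Q = (1 :: nat) \<longleftrightarrow> P \<noteq> Q" for P Q by (cases P; cases Q) simp_all
    ultimately show ?thesis using True by (simp add: set_eq_iff)
  next
    case False
    have "(S' \<subseteq> a \<and> (\<forall>x \<in> a0. x \<in> S' \<longleftrightarrow> x \<in> S) \<and> d \<notin> S' \<and> e \<notin> S') \<longleftrightarrow> S' = S" for S'
      using eq new S by blast
    then show ?thesis using False by (simp add: set_eq_iff)
  qed
  finally show ?thesis .
qed

text \<open>Compare coefficients in F(W(a)c). The monomial without X on the four-point circle gives
  the first relation; the one with X there gives the second, as either arc on that circle may supply
  the X.\<close>

lemma central_unnest:
  assumes z: "z \<in> ring_center (arc_ring k)"
    and a: "matching_on {..<2 * k} a" and c: "matching_on {..<2 * k} c"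
    and lt: "p < i" "i < j" "j < q"
    and eqs: "a = insert (i, j) (insert (p, q) a0)" "c = insert (p, i) (insert (j, q) a0)"
    and new: "(i, j) \<notin> a0" "(p, q) \<notin> a0" "(p, i) \<notin> a0" "(j, q) \<notin> a0" and S: "S \<subseteq> a0"
  defines "Z \<equiv> \<lambda>a S. Poly_Mapping.lookup z (arc_monomial k a S)"
  shows "Z a S = Z c S \<and>
      Z a (insert (i, j) S) + Z a (insert (p, q) S) = Z c (insert (p, i) S) + Z c (insert (j, q) S)"
proof -
  let ?Q = "{i, j, p, q}"
  have aB: "a \<in> crossingless_matchings k" and cB: "c \<in> crossingless_matchings k"
    using a c by (simp_all add: crossingless_matchings_iff)
  have fin: "finite a" "finite c" using finite_matching a c by blast+
  have W: "W_circles k a c = (\<lambda>e. {fst e, snd e}) ` a0 \<union> {?Q}"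
    by (rule W_circles_unnest[OF a c eqs new(1,2)])
  have sep: "fst x \<notin> ?Q" if "x \<in> a0" for x
  proof -
    obtain r s where x: "x = (r, s)" by (cases x)
    have "(r, s) \<noteq> (i, j)" "(r, s) \<noteq> (p, q)" "(r, s) \<in> a" "(i, j) \<in> a" "(p, q) \<in> a" using x that new eqs by auto
    then have "r \<notin> ?Q"
      using matching_on_share[OF a, of r s i j] matching_on_share[OF a, of r s p q] by blast
    then show ?thesis using x by simp
  qed
  let ?n = "\<lambda>t C. card {x \<in> S. fst x \<in> C} + of_bool (t \<and> C = ?Q)"
  have A: "{S' \<in> Pow a. \<forall>C \<in> W_circles k a c. card {x \<in> S'. fst x \<in> C} = ?n t C} =
    (if t then {insert (i, j) S, insert (p, q) S} else {S})" for t
    unfolding W by (rule arc_sets_with_counts[OF a eqs(1) new(1,2) _ _ _ sep S]) (use lt in auto)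
  have C: "{S' \<in> Pow c. \<forall>C \<in> W_circles k a c. card {x \<in> S'. fst x \<in> C} = ?n t C} =
    (if t then {insert (p, i) S, insert (j, q) S} else {S})" for t
    unfolding W by (rule arc_sets_with_counts[OF c eqs(2) new(3,4) _ _ _ sep S]) (use lt in auto)
  \<comment> \<open>The arcs of S are shared, so on the four-point circle only t contributes, and
    any other circle carries at most one arc.\<close>
  have n: "?n t C \<le> 1" if "C \<in> W_circles k a c" for t C
  proof (cases "C = ?Q")
    case True
    then have "{x \<in> S. fst x \<in> C} = {}" using sep S by blast
    then have "card {x \<in> S. fst x \<in> C} = 0" by (simp only: card.empty)
    then show ?thesis by (simp only:) simp
  next
    case False
    then obtain x where x: "x \<in> a0" "C = {fst x, snd x}" using \<open>C \<in> W_circles k a c\<close> W by blast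
    have "y = x" if "y \<in> S" "fst y \<in> C" for y
      by (rule matching_arc_eqI[OF a]) (use x that eqs S in auto)
    then have "{y \<in> S. fst y \<in> C} \<subseteq> {x}" by blast
    then have "card {y \<in> S. fst y \<in> C} \<le> card {x}" by (intro card_mono) auto
    then show ?thesis using False by simp
  qed
  have sum_filter: "(\<Sum>x\<in>A. g x * of_bool (P x)) = sum g {x \<in> A. P x}" if "finite A"
    for A :: "matching set" and g :: "matching \<Rightarrow> int" and P
    unfolding sum.inter_filter[OF that] by (rule sum.cong) auto
  have key: "sum (Z a) {S' \<in> Pow a. \<forall>C \<in> W_circles k a c. card {x \<in> S'. fst x \<in> C} = ?n t C} =
    sum (Z c) {S' \<in> Pow c. \<forall>C \<in> W_circles k a c. card {x \<in> S'. fst x \<in> C} = ?n t C}" for t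
    using central_restrictions_agree[OF z aB cB, where n = "?n t", OF n]
    unfolding sum_filter[OF finite_Pow_iff[THEN iffD2, OF fin(1)]] sum_filter[OF finite_Pow_iff[THEN iffD2, OF fin(2)]]
    by (simp only: Z_def)
  have "(i, j) \<notin> S" "(p, q) \<notin> S" "(p, i) \<notin> S" "(j, q) \<notin> S" using S new by auto
  moreover have "(i, j) \<noteq> (p, q)" "(p, i) \<noteq> (j, q)" using lt by auto
  ultimately have "insert (i, j) S \<noteq> insert (p, q) S" "insert (p, i) S \<noteq> insert (j, q) S"
    by (metis insertCI insertE)+
  then show ?thesis using key[of False] key[of True] unfolding A C by simp
qed

text \<open>The unnesting relations reduce every coefficient to outer ones, and a nonzero central
  element has a nonzero coefficient at some monomial. So the outer coefficients are injective
  coordinates on the center.\<close>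

lemma central_eq_0:
  assumes z: "z \<in> ring_center (arc_ring k)"
    and outer: "\<And>a S. a \<in> crossingless_matchings k \<Longrightarrow> outer a S \<Longrightarrow>
      Poly_Mapping.lookup z (arc_monomial k a S) = 0"
  shows "z = 0"
proof (rule ccontr)
  assume "z \<noteq> 0"
  then have "Poly_Mapping.keys z \<noteq> {}" by simp
  then obtain p where p: "p \<in> Poly_Mapping.keys z" by blast
  obtain a S where aS: "a \<in> crossingless_matchings k" "S \<subseteq> a" "p = arc_monomial k a S"
    using central_keys[OF z p] .
  have "Poly_Mapping.lookup z (arc_monomial k a S) = 0"
    by (rule vanish_if_vanish_outer[of "{..<2 * k}" "\<lambda>a S. Poly_Mapping.lookup z (arc_monomial k a S)"])
      (use outer central_unnest[OF z] aS in \<open>simp_all add: crossingless_matchings_iff\<close>)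
  then show False using p aS by (simp add: in_keys_iff)
qed

section \<open>A basis of the center\<close>

text \<open>Q is built up by increasing weight. The new x has maximal weight, so its column vanishes
  in all earlier rows, and only the equation at x is left; the diagonal entry 1 solves it over the
  integers.\<close>

lemma unitriangular_ex_solution:
  fixes M :: "'q \<Rightarrow> 'q \<Rightarrow> int" and w :: "'q \<Rightarrow> nat"
  assumes "finite Q" "\<And>x. x \<in> Q \<Longrightarrow> M x x = 1"
    and "\<And>x y. x \<in> Q \<Longrightarrow> y \<in> Q \<Longrightarrow> x \<noteq> y \<Longrightarrow> M x y \<noteq> 0 \<Longrightarrow> w y < w x"
  shows "\<exists>c. \<forall>x \<in> Q. (\<Sum>y\<in>Q. c y * M x y) = v x"
  using assms
proof (induction Q rule: finite_ranking_induct[where f = w])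
  case (insert x Q)
  show ?case
  proof (cases "x \<in> Q")
    case True
    then show ?thesis using insert by (simp add: insert_absorb)
  next
    case False
    obtain c where c: "\<And>y. y \<in> Q \<Longrightarrow> (\<Sum>u\<in>Q. c u * M y u) = v y"
      using insert.IH insert.prems by (metis insertCI)
    define c' where "c' = c(x := v x - (\<Sum>u\<in>Q. c u * M x u))"
    have "(\<Sum>u\<in>insert x Q. c' u * M y u) = v y" if "y \<in> insert x Q" for y
    proof -
      have "(\<Sum>u\<in>Q. c' u * M y u) = (\<Sum>u\<in>Q. c u * M y u)"
        using False by (intro sum.cong) (auto simp: c'_def)
      then have eq: "(\<Sum>u\<in>insert x Q. c' u * M y u) = c' x * M y x + (\<Sum>u\<in>Q. c u * M y u)"
        using insert.hyps False by simp
      show ?thesis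
      proof (cases "y = x")
        case True
        then show ?thesis using eq insert.prems(1)[of x] by (simp add: c'_def)
      next
        case ne: False
        then have "y \<in> Q" using that by simp
        then have "M y x = 0" using insert.prems(2)[of y x] insert.hyps(2)[of y] ne by fastforce
        then show ?thesis using eq c[OF \<open>y \<in> Q\<close>] by simp
      qed
    qed
    then show ?thesis by blast
  qed
qed simp

lemma unitriangular_kernel:
  fixes M :: "'q \<Rightarrow> 'q \<Rightarrow> int" and w :: "'q \<Rightarrow> nat"
  assumes "finite Q" "\<And>x. x \<in> Q \<Longrightarrow> M x x = 1"
    and "\<And>x y. x \<in> Q \<Longrightarrow> y \<in> Q \<Longrightarrow> x \<noteq> y \<Longrightarrow> M x y \<noteq> 0 \<Longrightarrow> w y < w x"
    and "\<And>x. x \<in> Q \<Longrightarrow> (\<Sum>y\<in>Q. c y * M x y) = 0" and "x \<in> Q"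
  shows "c x = 0"
  using \<open>x \<in> Q\<close>
proof (induction "w x" arbitrary: x rule: less_induct)
  case less
  have "c y * M x y = 0" if "y \<in> Q - {x}" for y
  proof (cases "M x y = 0")
    case False
    then have "w y < w x" using assms(3)[of x y] less.prems that by auto
    then show ?thesis using less.hyps[of y] that by simp
  qed simp
  then have "(\<Sum>y\<in>Q - {x}. c y * M x y) = 0" by (rule sum.neutral[OF ballI])
  then have "(\<Sum>y\<in>Q. c y * M x y) = c x * M x x"
    using assms(1) less.prems by (simp add: sum.remove[of Q x])
  then show ?case using assms(2,4) less.prems by simp
qed

section \<open>Coordinates indexed by ballot sets\<close>

definition standard_cup_diagram :: "nat \<Rightarrow> nat set \<Rightarrow> matching \<times> matching" where
  "standard_cup_diagram k T = (THE D. cup_diagram {..<2 * k} T D)"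

lemma standard_cup_diagram:
  assumes "ballot {..<2 * k} T"
  shows "cup_diagram {..<2 * k} T (standard_cup_diagram k T)"
  unfolding standard_cup_diagram_def
  by (rule theI', rule ex1_cup_diagram) (use assms in auto)

lemma standard_cup_diagram_eqI:
  assumes "cup_diagram {..<2 * k} T D" "ballot {..<2 * k} T"
  shows "standard_cup_diagram k T = D"
  unfolding standard_cup_diagram_def
  by (rule the1_equality, rule ex1_cup_diagram) (use assms in auto)

definition standard_coeff :: "nat \<Rightarrow> (arc_gen \<Rightarrow>\<^sub>0 int) \<Rightarrow> nat set \<Rightarrow> int" where
  "standard_coeff k z T =
    Poly_Mapping.lookup z (case standard_cup_diagram k T of (a, S) \<Rightarrow> arc_monomial k a S)"

lemma standard_coeff_point_class:
  assumes "ballot {..<2 * k} T" "standard_cup_diagram k T = (a, S)"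
  shows "standard_coeff k (point_class k T') T =
    of_bool ((\<forall>e \<in> a. \<not> (fst e \<in> T' \<and> snd e \<in> T')) \<and> {e \<in> a. fst e \<in> T' \<or> snd e \<in> T'} = S)"
proof -
  have "cup_diagram {..<2 * k} T (a, S)" using standard_cup_diagram[OF assms(1)] assms(2) by simp
  then have "a \<in> crossingless_matchings k" "S \<subseteq> a"
    by (auto simp: cup_diagram_def outer_def crossingless_matchings_iff)
  then show ?thesis
    unfolding standard_coeff_def assms(2) prod.case by (rule lookup_point_class)
qed

text \<open>T consists of the right endpoints of S, and no point is both a left and a right
  endpoint. So no arc has two points in T, and the arcs meeting T are those of S.\<close>

lemma standard_coeff_same:
  assumes "ballot {..<2 * k} T"
  shows "standard_coeff k (point_class k T) T = 1"
proof -
  obtain a S where aS: "standard_cup_diagram k T = (a, S)" by force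
  then have "cup_diagram {..<2 * k} T (a, S)" using standard_cup_diagram[OF assms] by simp
  then have m: "matching_on {..<2 * k} a" and S: "S \<subseteq> a" and T: "T = snd ` S"
    by (auto simp: cup_diagram_def outer_def)
  have "fst e \<notin> T" if "e \<in> a" for e
    using fst_noteq_snd_matching[OF m that] S T by blast
  moreover have "snd e \<in> T \<longleftrightarrow> e \<in> S" if "e \<in> a" for e
    unfolding T using inj_on_image_mem_iff[OF inj_on_snd_matching[OF m] that S] .
  ultimately show ?thesis
    unfolding standard_coeff_point_class[OF assms aS] using S by auto
qed

text \<open>
  A nonzero coefficient means that \<open>T'\<close> picks one endpoint of each arc of the cup diagram of \<open>T\<close>,
  while \<open>T\<close> picks the right endpoints.
\<close>

lemma standard_coeff_less:
  assumes "ballot {..<2 * k} T" "ballot {..<2 * k} T'" "T \<noteq> T'"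
    and "standard_coeff k (point_class k T') T \<noteq> 0"
  shows "\<Sum>T' < \<Sum>T"
proof -
  obtain a S where aS: "standard_cup_diagram k T = (a, S)" by force
  then have "cup_diagram {..<2 * k} T (a, S)" using standard_cup_diagram[OF assms(1)] by simp
  then have m: "matching_on {..<2 * k} a" and S: "S \<subseteq> a" and T: "T = snd ` S"
    by (auto simp: cup_diagram_def outer_def)
  have fin: "finite S" using finite_subset[OF S finite_matching[OF m]] by simp
  have ok: "\<And>e. e \<in> a \<Longrightarrow> \<not> (fst e \<in> T' \<and> snd e \<in> T')" and meet: "{e \<in> a. fst e \<in> T' \<or> snd e \<in> T'} = S"
    using assms(4) unfolding standard_coeff_point_class[OF assms(1) aS] by (simp_all split: if_splits)
  let ?h = "\<lambda>e. if fst e \<in> T' then fst e else snd e"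
  have h: "?h e \<in> T'" if "e \<in> S" for e using that meet by auto
  have le: "?h e \<le> snd e" if "e \<in> S" for e
    using that S matching_onD(1)[OF m, of "fst e" "snd e"] by auto
  have T': "T' = ?h ` S"
  proof (intro equalityI subsetI)
    fix t assume t: "t \<in> T'"
    then have "t \<in> {..<2 * k}" using assms(2) by (auto simp: ballot_def)
    then obtain i j where ij: "(i, j) \<in> a" "t = i \<or> t = j" using matching_on_cover[OF m] by metis
    then have "(i, j) \<in> S" using meet t by auto
    moreover have "t = ?h (i, j)" using ok[OF ij(1)] ij(2) t by auto
    ultimately show "t \<in> ?h ` S" by blast
  qed (use h in blast)
  have inj: "inj_on ?h S"
  proof (rule inj_onI)
    fix x y assume xy: "x \<in> S" "y \<in> S" "?h x = ?h y"
    obtain i j r s where eqs: "x = (i, j)" "y = (r, s)" by (cases x, cases y)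
    then have "i = r \<or> i = s \<or> j = r \<or> j = s" using xy(3) by (auto split: if_splits)
    moreover have "(i, j) \<in> a" "(r, s) \<in> a" using xy S eqs by auto
    ultimately show "x = y" using matching_on_share[OF m, of i j r s] eqs by blast
  qed
  \<comment> \<open>If every arc contributed its right endpoint, T' would equal T; so some endpoint
    moves to the left and the sum drops.\<close>
  have "\<exists>e \<in> S. ?h e < snd e"
  proof (rule ccontr)
    assume "\<not> (\<exists>e \<in> S. ?h e < snd e)"
    then have "?h e = snd e" if "e \<in> S" for e using le[OF that] that by force
    then have "?h ` S = snd ` S" by (intro image_cong) auto
    then show False using T T' assms(3) by simp
  qed
  then have "(\<Sum>e\<in>S. ?h e) < (\<Sum>e\<in>S. snd e)"
    using fin le by (intro sum_strict_mono_ex1) auto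
  moreover have "\<Sum>T' = (\<Sum>e\<in>S. ?h e)"
    using sum.reindex[OF inj, of "\<lambda>x. x"] by (simp only: T'[symmetric] o_def)
  moreover have "\<Sum>T = (\<Sum>e\<in>S. snd e)"
    unfolding T using inj_on_subset[OF inj_on_snd_matching[OF m] S] by (subst sum.reindex) auto
  ultimately show ?thesis by simp
qed

lemma standard_coeff_sum:
  "standard_coeff k (\<Sum>T\<in>Q. frag_cmul (c T) (point_class k T)) T' =
    (\<Sum>T\<in>Q. c T * standard_coeff k (point_class k T) T')"
  by (simp add: standard_coeff_def lookup_sum)

abbreviation ballots :: "nat \<Rightarrow> nat set set" where
  "ballots k \<equiv> {T. ballot {..<2 * k} T}"

lemma point_classes_independent:
  assumes "(\<Sum>T\<in>ballots k. frag_cmul (c T) (point_class k T)) = 0" "T \<in> ballots k"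
  shows "c T = 0"
proof (rule unitriangular_kernel[where M = "\<lambda>T' T. standard_coeff k (point_class k T) T'" and w = "\<lambda>T. \<Sum>T"])
  show "(\<Sum>T\<in>ballots k. c T * standard_coeff k (point_class k T) T') = 0" for T'
    unfolding standard_coeff_sum[symmetric] assms(1) by (simp add: standard_coeff_def)
qed (use assms(2) finite_ballot standard_coeff_same standard_coeff_less in auto)

text \<open>Solving the unitriangular system makes the difference \<open>z - ?w\<close> vanish in
  all ballot coordinates. Every outer pair (a, S) is the diagram of the right endpoints of S, so all
  outer coefficients vanish and the difference is zero.\<close>

lemma point_classes_span:
  assumes z: "z \<in> ring_center (arc_ring k)"
  obtains c where "z = (\<Sum>T\<in>ballots k. frag_cmul (c T) (point_class k T))"
proof -
  have "\<exists>c. \<forall>T' \<in> ballots k. (\<Sum>T\<in>ballots k. c T * standard_coeff k (point_class k T) T') = standard_coeff k z T'"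
    by (rule unitriangular_ex_solution[where w = "\<lambda>T. \<Sum>T"])
      (use finite_ballot standard_coeff_same standard_coeff_less in auto)
  then obtain c where c: "\<forall>T' \<in> ballots k. (\<Sum>T\<in>ballots k. c T * standard_coeff k (point_class k T) T') = standard_coeff k z T'"
    by blast
  let ?w = "\<Sum>T\<in>ballots k. frag_cmul (c T) (point_class k T)"
  have "z - ?w = 0"
  proof (rule central_eq_0)
    show "z - ?w \<in> ring_center (arc_ring k)"
      using z finite_ballot by (intro ring_center_diff ring_center_sum point_class_central)
    show "Poly_Mapping.lookup (z - ?w) (arc_monomial k a S) = 0"
      if a: "a \<in> crossingless_matchings k" and S: "outer a S" for a S
    proof -
      have m: "matching_on {..<2 * k} a" using a by (simp add: crossingless_matchings_iff)
      have T: "ballot {..<2 * k} (snd ` S)"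
        using S by (intro ballot_cup_diagram[OF m]) (auto simp: outer_def)
      have D: "standard_cup_diagram k (snd ` S) = (a, S)"
        by (rule standard_cup_diagram_eqI[OF _ T]) (use m S in \<open>simp add: cup_diagram_def\<close>)
      have "standard_coeff k z (snd ` S) = standard_coeff k ?w (snd ` S)"
        using c T unfolding standard_coeff_sum by simp
      then show ?thesis by (simp add: standard_coeff_def D lookup_minus)
    qed
  qed
  then show ?thesis using that by simp
qed

section \<open>Homogeneous components and ranks\<close>

text \<open>In each nonzero component, the arcs meeting T are as many as the elements of T, so all
  terms have the same degree.\<close>

lemma homogeneous_component_point_class:
  assumes "T \<subseteq> {..<2 * k}"
  shows "homogeneous_component k n (point_class k T) = (if n = 2 * int (card T) then point_class k T else 0)"
proof -
  let ?B = "crossingless_matchings k"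
  let ?u = "\<lambda>a. if \<forall>e \<in> a. \<not> (fst e \<in> T \<and> snd e \<in> T)
     then frag_of (arc_monomial k a {e \<in> a. fst e \<in> T \<or> snd e \<in> T}) else 0"
  let ?F = "frag_extend (\<lambda>p. if arc_deg k p = n then frag_of p else 0)"
  have "?F (?u a) = (if n = 2 * int (card T) then ?u a else 0)" if a: "a \<in> ?B" for a
  proof (cases "\<forall>e \<in> a. \<not> (fst e \<in> T \<and> snd e \<in> T)")
    case True
    let ?S = "{e \<in> a. fst e \<in> T \<or> snd e \<in> T}"
    have m: "matching_on {..<2 * k} a" using a by (simp add: crossingless_matchings_iff)
    have "card {e \<in> a. (fst e \<in> T \<or> snd e \<in> T) \<and> fst e \<in> {..<2 * k}} = card (T \<inter> {..<2 * k})"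
      by (rule card_arcs_meeting[OF m order_refl _ True]) (use matching_onD[OF m] in blast)
    moreover have "{e \<in> a. (fst e \<in> T \<or> snd e \<in> T) \<and> fst e \<in> {..<2 * k}} = ?S"
      using matching_onD(2)[OF m] by auto
    moreover have "T \<inter> {..<2 * k} = T" using assms by auto
    ultimately have "card ?S = card T" by simp
    then have "arc_deg k (arc_monomial k a ?S) = 2 * int (card T)"
      using arc_deg_arc_monomial[OF a, of ?S] by auto
    then show ?thesis unfolding if_P[OF True] by auto
  next
    case False
    then show ?thesis unfolding if_not_P[OF False] by simp
  qed
  then show ?thesis
    unfolding homogeneous_component_def point_class_def frag_extend_sum[OF finite_crossingless_matchings] o_def
    by simp
qed

lemma homogeneous_component_span:
  "homogeneous_component k n (\<Sum>T\<in>ballots k. frag_cmul (c T) (point_class k T)) =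
    (\<Sum>T\<in>{T \<in> ballots k. n = 2 * int (card T)}. frag_cmul (c T) (point_class k T))"
proof -
  have "homogeneous_component k n (\<Sum>T\<in>ballots k. frag_cmul (c T) (point_class k T)) =
    (\<Sum>T\<in>ballots k. frag_cmul (c T) (homogeneous_component k n (point_class k T)))"
    by (simp add: homogeneous_component_def frag_extend_sum[OF finite_ballot] frag_extend_cmul)
  also have "\<dots> = (\<Sum>T\<in>ballots k. if n = 2 * int (card T) then frag_cmul (c T) (point_class k T) else 0)"
    by (intro sum.cong refl) (auto simp: homogeneous_component_point_class ballot_def)
  also have "\<dots> = (\<Sum>T\<in>{T \<in> ballots k. n = 2 * int (card T)}. frag_cmul (c T) (point_class k T))"
    by (rule sum.inter_filter[OF finite_ballot, symmetric])
  finally show ?thesis .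
qed

lemma homogeneous_component_eq_self:
  assumes "\<And>p. p \<in> Poly_Mapping.keys z \<Longrightarrow> arc_deg k p = n"
  shows "homogeneous_component k n z = z"
proof -
  have "homogeneous_component k n z = frag_extend frag_of z"
    unfolding homogeneous_component_def using assms by (intro frag_extend_eq) simp
  then show ?thesis by (simp flip: frag_expansion)
qed

lemma keys_homogeneous_component:
  assumes "p \<in> Poly_Mapping.keys (homogeneous_component k n z)"
  shows "arc_deg k p = n"
  using assms unfolding homogeneous_component_def in_keys_iff lookup_frag_extend_filter
  by (simp split: if_splits)

lemma ring_center_eq_span:
  "ring_center (arc_ring k) = {\<Sum>T\<in>ballots k. frag_cmul (c T) (point_class k T) | c. True}"
proof (intro equalityI subsetI)
  fix z assume "z \<in> ring_center (arc_ring k)"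
  then obtain c where "z = (\<Sum>T\<in>ballots k. frag_cmul (c T) (point_class k T))"
    using point_classes_span by blast
  then show "z \<in> {\<Sum>T\<in>ballots k. frag_cmul (c T) (point_class k T) | c. True}" by blast
next
  fix z assume "z \<in> {\<Sum>T\<in>ballots k. frag_cmul (c T) (point_class k T) | c. True}"
  then obtain c where c: "z = (\<Sum>T\<in>ballots k. frag_cmul (c T) (point_class k T))" by blast
  show "z \<in> ring_center (arc_ring k)"
    unfolding c using finite_ballot by (intro ring_center_sum point_class_central)
qed

lemma center_in_degree_eq_span:
  "center_in_degree k n =
    {\<Sum>T\<in>{T \<in> ballots k. n = 2 * int (card T)}. frag_cmul (c T) (point_class k T) | c. True}"
proof (intro equalityI subsetI)
  fix z assume z: "z \<in> center_in_degree k n"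
  then obtain c where c: "z = (\<Sum>T\<in>ballots k. frag_cmul (c T) (point_class k T))"
    using point_classes_span by (auto simp: center_in_degree_def)
  have "z = homogeneous_component k n z"
    using z homogeneous_component_eq_self by (auto simp: center_in_degree_def)
  then show "z \<in> {\<Sum>T\<in>{T \<in> ballots k. n = 2 * int (card T)}. frag_cmul (c T) (point_class k T) | c. True}"
    unfolding c homogeneous_component_span by blast
next
  fix z assume "z \<in> {\<Sum>T\<in>{T \<in> ballots k. n = 2 * int (card T)}. frag_cmul (c T) (point_class k T) | c. True}"
  then obtain c where c: "z = (\<Sum>T\<in>{T \<in> ballots k. n = 2 * int (card T)}. frag_cmul (c T) (point_class k T))"
    by blast
  have "z \<in> ring_center (arc_ring k)"
    unfolding c using finite_ballot by (intro ring_center_sum point_class_central) auto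
  moreover have "arc_deg k p = n" if "p \<in> Poly_Mapping.keys z" for p
    using that unfolding c homogeneous_component_span[symmetric] by (rule keys_homogeneous_component)
  ultimately show "z \<in> center_in_degree k n" by (simp add: center_in_degree_def)
qed

text \<open>Integer combinations fill the carrier, and independence makes the coordinates unique.
  Numbering Q carries this over to the index set that \<open>free_abelian_of_rank\<close> asks
  for.\<close>

lemma free_abelian_of_rankI:
  fixes u :: "'q \<Rightarrow> 'g \<Rightarrow>\<^sub>0 int"
  assumes Q: "finite Q" and carrier: "carrier G = {\<Sum>T\<in>Q. frag_cmul (c T) (u T) | c. True}"
    and mult: "\<And>x y. x \<otimes>\<^bsub>G\<^esub> y = x + y"
    and indep: "\<And>c T. (\<Sum>T\<in>Q. frag_cmul (c T) (u T)) = 0 \<Longrightarrow> T \<in> Q \<Longrightarrow> c T = 0"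
  shows "free_abelian_of_rank G (int (card Q))"
proof -
  obtain h where h: "bij_betw h {..<card Q} Q"
    using ex_bij_betw_nat_finite[OF Q] by (auto simp: atLeast0LessThan)
  define F where "F = free_Abelian_group {..<card Q}"
  let ?\<phi> = "frag_extend (u \<circ> h)"
  have \<phi>: "?\<phi> v = (\<Sum>n<card Q. frag_cmul (Poly_Mapping.lookup v n) (u (h n)))"
    if "Poly_Mapping.keys v \<subseteq> {..<card Q}" for v
    unfolding frag_extend_def o_def using that
    by (intro sum.mono_neutral_left) (auto simp: in_keys_iff)
  have reindex: "(\<Sum>T\<in>Q. g T) = (\<Sum>n<card Q. g (h n))" for g :: "'q \<Rightarrow> 'g \<Rightarrow>\<^sub>0 int"
    using sum.reindex_bij_betw[OF h, of g] by simp
  let ?c = "\<lambda>v T. Poly_Mapping.lookup v (inv_into {..<card Q} h T)"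
  have inv: "inv_into {..<card Q} h (h n) = n" if "n < card Q" for n
    using h that by (simp add: bij_betw_def inv_into_f_f)
  have \<phi>Q: "?\<phi> v = (\<Sum>T\<in>Q. frag_cmul (?c v T) (u T))" if "Poly_Mapping.keys v \<subseteq> {..<card Q}" for v
    unfolding reindex \<phi>[OF that] by (intro sum.cong) (simp_all add: inv)
  have "?\<phi> \<in> hom F G"
    using \<phi>Q by (auto simp: hom_def F_def mult frag_extend_add carrier)
  moreover have "inj_on ?\<phi> (carrier F)"
  proof (rule inj_onI)
    fix v w assume v: "v \<in> carrier F" and w: "w \<in> carrier F" and eq: "?\<phi> v = ?\<phi> w"
    have keys: "Poly_Mapping.keys (v - w) \<subseteq> {..<card Q}"
      using v w keys_diff[of v w] by (auto simp: F_def)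
    have "?\<phi> (v - w) = 0" using eq by (simp add: frag_extend_diff)
    then have zero: "(\<Sum>T\<in>Q. frag_cmul (?c (v - w) T) (u T)) = 0" using \<phi>Q[OF keys] by simp
    have "Poly_Mapping.lookup (v - w) n = 0" for n
    proof (cases "n < card Q")
      case True
      then have "h n \<in> Q" using h by (auto simp: bij_betw_def)
      then show ?thesis using indep[OF zero, of "h n"] inv[OF True] by simp
    next
      case False
      then show ?thesis using keys by (auto simp: in_keys_iff)
    qed
    then have "v - w = 0" by (intro poly_mapping_eqI) simp
    then show "v = w" by simp
  qed
  moreover have "?\<phi> ` carrier F = carrier G"
  proof (intro equalityI subsetI)
    fix x assume "x \<in> ?\<phi> ` carrier F"
    then show "x \<in> carrier G" using \<phi>Q unfolding carrier F_def by auto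
  next
    fix x assume "x \<in> carrier G"
    then obtain c where x: "x = (\<Sum>T\<in>Q. frag_cmul (c T) (u T))" unfolding carrier by blast
    define v where "v = (\<Sum>n<card Q. frag_cmul (c (h n)) (frag_of n))"
    have "Poly_Mapping.keys v \<subseteq> (\<Union>n\<in>{..<card Q}. Poly_Mapping.keys (frag_cmul (c (h n)) (frag_of n)))"
      unfolding v_def by (rule keys_sum)
    then have "v \<in> carrier F" by (auto simp: F_def)
    moreover have "?\<phi> v = x"
      unfolding v_def x reindex by (simp add: frag_extend_sum frag_extend_cmul)
    ultimately show "x \<in> ?\<phi> ` carrier F" by blast
  qed
  ultimately have "F \<cong> G" by (auto simp: is_iso_def iso_def bij_betw_def)
  \<comment> \<open>The map starts from the free group, where the group axioms are at hand; symmetry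
    then gives the required direction.\<close>
  then have "G \<cong> F" unfolding F_def by (rule group.iso_sym[OF group_free_Abelian_group])
  then show ?thesis unfolding free_abelian_of_rank_def F_def by blast
qed

lemma card_ballots_total: "int (card (ballots k)) = int (2 * k choose k)"
proof -
  let ?N = "\<lambda>i. {T. ballot {..<2 * k} T \<and> card T = i}"
  have fin: "finite (?N i)" for i by (rule finite_subset[OF _ finite_ballot]) auto
  have "ballots k = (\<Union>i\<in>{..k}. ?N i)" using ballot_card_le[of "2 * k"] by auto
  then have "card (ballots k) = (\<Sum>i\<le>k. card (?N i))"
    using fin by (simp only:) (rule card_UN_disjoint; auto)
  then have "int (card (ballots k)) = (\<Sum>i\<le>k. int (card (?N i)))" by simp
  also have "\<dots> = (\<Sum>i\<le>k. int (2 * k choose i) - (if i = 0 then 0 else int (2 * k choose (i - 1))))"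
    by (intro sum.cong refl card_ballot) simp
  also have "\<dots> = int (2 * k choose k)"
  proof -
    \<comment> \<open>The sum over the degrees telescopes, and only the last binomial coefficient
      survives.\<close>
    have "(\<Sum>i\<le>m. int (n choose i) - (if i = 0 then 0 else int (n choose (i - 1)))) = int (n choose m)" for m n
      by (induction m) auto
    then show ?thesis .
  qed
  finally show ?thesis .
qed

theorem proposition1:
  fixes k :: nat
  assumes "k > 0"
  shows
    "(\<forall>z \<in> ring_center (arc_ring k). \<forall>n. homogeneous_component k n z \<in> ring_center (arc_ring k)) \<and>
     (\<forall>i \<in> {0..k}.
        free_abelian_of_rank
          (additive_group_on (arc_ring k) (center_in_degree k (2 * int i)))
          (binom (2 * int k) (int i) - binom (2 * int k) (int i - 1))) \<and>
     (\<forall>n. (\<forall>i \<in> {0..k}. n \<noteq> 2 * int i) \<longrightarrow> center_in_degree k n = {\<zero>\<^bsub>arc_ring k\<^esub>}) \<and>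
     free_abelian_of_rank
       (additive_group_on (arc_ring k) (ring_center (arc_ring k)))
       (binom (2 * int k) (int k))"
proof (intro conjI ballI allI impI)
  have add: "x \<oplus>\<^bsub>arc_ring k\<^esub> y = x + y" for x y
    by (simp add: arc_ring_def)
  show "homogeneous_component k n z \<in> ring_center (arc_ring k)"
    if z: "z \<in> ring_center (arc_ring k)" for z n
  proof -
    obtain c where c: "z = (\<Sum>T\<in>ballots k. frag_cmul (c T) (point_class k T))"
      using point_classes_span[OF z] .
    have "finite {T \<in> ballots k. n = 2 * int (card T)}" using finite_ballot by simp
    then show ?thesis
      unfolding c homogeneous_component_span by (intro ring_center_sum point_class_central)
  qed
  show "free_abelian_of_rank (additive_group_on (arc_ring k) (center_in_degree k (2 * int i)))
      (binom (2 * int k) (int i) - binom (2 * int k) (int i - 1))"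
    if i: "i \<in> {0..k}" for i
  proof -
    let ?Q = "{T \<in> ballots k. 2 * int i = 2 * int (card T)}"
    have "free_abelian_of_rank (additive_group_on (arc_ring k) (center_in_degree k (2 * int i))) (int (card ?Q))"
    proof (rule free_abelian_of_rankI[where u = "point_class k"])
      show "finite ?Q" using finite_ballot by simp
      fix c T assume "(\<Sum>T\<in>?Q. frag_cmul (c T) (point_class k T)) = 0" and T: "T \<in> ?Q"
      \<comment> \<open>Extending c by zero outside degree 2 i turns the relation into one among all
        ballot classes, where independence is known.\<close>
      moreover have "(\<Sum>T\<in>?Q. frag_cmul (c T) (point_class k T)) =
        (\<Sum>T\<in>ballots k. if 2 * int i = 2 * int (card T) then frag_cmul (c T) (point_class k T) else 0)"
        by (rule sum.inter_filter[OF finite_ballot])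
      moreover have "\<dots> = (\<Sum>T\<in>ballots k.
          frag_cmul (if 2 * int i = 2 * int (card T) then c T else 0) (point_class k T))"
        by (rule sum.cong) auto
      ultimately have "(\<Sum>T\<in>ballots k.
          frag_cmul (if 2 * int i = 2 * int (card T) then c T else 0) (point_class k T)) = 0"
        by simp
      from point_classes_independent[OF this, of T] show "c T = 0" using T by simp
    qed (simp_all add: center_in_degree_eq_span add)
    moreover have "int (card ?Q) = binom (2 * int k) (int i) - binom (2 * int k) (int i - 1)"
    proof -
      have "?Q = {T. ballot {..<2 * k} T \<and> card T = i}" by auto
      \<comment> \<open>At i = 0 the integer i - 1 is negative and \<open>binom\<close> is 0 there,
        in line with the case distinction in \<open>card_ballot\<close>.\<close>
      moreover have "nat (2 * int k) = 2 * k" "i \<noteq> 0 \<Longrightarrow> nat (int i - 1) = i - 1" by auto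
      ultimately show ?thesis using card_ballot[of i "2 * k"] i by (auto simp: binom_def)
    qed
    ultimately show ?thesis by simp
  qed
  show "center_in_degree k n = {\<zero>\<^bsub>arc_ring k\<^esub>}" if n: "\<forall>i \<in> {0..k}. n \<noteq> 2 * int i" for n
  proof -
    have "n \<noteq> 2 * int (card T)" if "T \<in> ballots k" for T
    proof -
      have "2 * card T \<le> 2 * k" using that ballot_card_le by blast
      then show ?thesis using n by auto
    qed
    then have empty: "{T \<in> ballots k. n = 2 * int (card T)} = {}" by blast
    show ?thesis unfolding center_in_degree_eq_span empty by (simp add: arc_ring_def)
  qed
  have "free_abelian_of_rank (additive_group_on (arc_ring k) (ring_center (arc_ring k))) (int (card (ballots k)))"
    by (rule free_abelian_of_rankI[where u = "point_class k"])
      (use finite_ballot point_classes_independent in \<open>simp_all add: ring_center_eq_span add\<close>)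
  moreover have "int (card (ballots k)) = binom (2 * int k) (int k)"
  proof -
    have "nat (2 * int k) = 2 * k" by simp
    then show ?thesis using card_ballots_total[of k] by (simp add: binom_def)
  qed
  ultimately show "free_abelian_of_rank (additive_group_on (arc_ring k) (ring_center (arc_ring k)))
    (binom (2 * int k) (int k))" by simp
qed

end
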